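(* Let $\Psi(\tau)=\tau\int_0^{\tau}e^{-x^2/2}\,dx+e^{-\tau^2/2}$ for $\tau\ge 0$. The sharp constant $C$ in the inequality $$\frac{1}{|J|}\big|\{x\in J:\ S_J^2\varphi(x)\ge\lambda\}\big|\ \le\ C\,\frac{1}{\sqrt{\lambda}}\,\langle|\varphi|\rangle_J\qquad\text{for all }\varphi\in L^1(J),\ J\in\mathcal D,\ \lambda>0,$$ is $C=\Psi(1)$.
   Context: $\mathcal D$ denotes the standard collection of dyadic intervals of $\mathbb R$. For $I\in\mathcal D$, $I_-$ and $I_+$ are its left and right halves, $\mathbf 1_I$ its indicator function, and $|E|$ denotes Lebesgue measure. For integrable $\varphi$, $\langle\varphi\rangle_I=\frac1{|I|}\int_I\varphi\,dx$. Functions are real-valued. For $J\in\mathcal D$ the (localized) dyadic square function is given by $$S_J^2\varphi(x)=\sum_{I\in\mathcal D,\ I\subseteq J}|\Delta_I\varphi|^2\,\mathbf 1_I(x),\qquad \Delta_I\varphi=\tfrac12\big(\langle\varphi\rangle_{I_+}-\langle\varphi\rangle_{I_-}\big)\big(\mathbf 1_{I_+}-\mathbf 1_{I_-}\big),$$ so that $|\Delta_I\varphi|^2\mathbf 1_I=\frac14(\langle\varphi\rangle_{I_+}-\langle\varphi\rangle_{I_-})^2\mathbf 1_I$. "The sharp constant" is the smallest constant $C$ for which the inequality holds for all the indicated $\varphi$, $J$, $\lambda$. *)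

theory Defs
  imports "HOL-Analysis.Analysis"
begin

text \<open>Dyadic intervals of all generations \<open>n \<in> \<int>\<close>, taken half-open, so that each
  interval is the disjoint union of its two halves.\<close>

definition dyadic :: "real set set" where
  "dyadic = {{of_int k * 2 powi (- n) ..< (of_int k + 1) * 2 powi (- n)} | (k::int) (n::int). True}"

definition left_half :: "real set \<Rightarrow> real set" where
  "left_half I = {Inf I ..< (Inf I + Sup I) / 2}"

definition right_half :: "real set \<Rightarrow> real set" where
  "right_half I = {(Inf I + Sup I) / 2 ..< Sup I}"

definition avg :: "real set \<Rightarrow> (real \<Rightarrow> real) \<Rightarrow> real" where
  "avg I \<phi> = (1 / measure lebesgue I) * (LINT x:I|lebesgue. \<phi> x)"

definition Delta :: "real set \<Rightarrow> (real \<Rightarrow> real) \<Rightarrow> real \<Rightarrow> real" where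
  "Delta I \<phi> x = 1 / 2 * (avg (right_half I) \<phi> - avg (left_half I) \<phi>)
      * (indicator (right_half I) x - indicator (left_half I) x)"

text \<open>The square of the square function. The series of nonnegative terms may diverge at some
  points, so its value is taken in \<open>[0, \<infinity>]\<close>; there every such family is summable.\<close>

definition sqfun2 :: "real set \<Rightarrow> (real \<Rightarrow> real) \<Rightarrow> real \<Rightarrow> ennreal" where
  "sqfun2 J \<phi> x = (\<Sum>\<^sub>\<infinity>I\<in>{I \<in> dyadic. I \<subseteq> J}. ennreal (\<bar>Delta I \<phi> x\<bar>\<^sup>2 * indicator I x))"

definition Psi :: "real \<Rightarrow> real" where
  "Psi \<tau> = \<tau> * integral {0..\<tau>} (\<lambda>x. exp (- x\<^sup>2 / 2)) + exp (- \<tau>\<^sup>2 / 2)"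

definition weak_type_ineq :: "real \<Rightarrow> bool" where
  "weak_type_ineq C \<longleftrightarrow>
    (\<forall>J\<in>dyadic. \<forall>\<phi>. \<forall>lam>0. set_integrable lebesgue J \<phi> \<longrightarrow>
      1 / measure lebesgue J * measure lebesgue {x \<in> J. sqfun2 J \<phi> x \<ge> ennreal lam}
        \<le> C * (1 / sqrt lam) * avg J (\<lambda>x. \<bar>\<phi> x\<bar>))"

end

theory Submission
  imports Defs
begin

text \<open>
  The function \<open>U x l = sqrt l * Psi (\<bar>x\<bar> / sqrt l)\<close> solves the heat equation \<open>U\<^sub>l = U\<^sub>x\<^sub>x / 2\<close>; cut off to
  \<open>Psi 1 * \<bar>x\<bar>\<close> outside the parabola \<open>x\<^sup>2 < l\<close>, it satisfies
  \<open>2 * U x l \<le> U (x + d) (l - d\<^sup>2) + U (x - d) (l - d\<^sup>2)\<close> for all steps \<open>d\<close>. Here \<open>x\<close> is the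
  current average and \<open>l\<close> the part of the square function that is still missing, so one dyadic
  generation is such a step. Iterating over the generations, with \<open>sqrt l \<le> U x l\<close> at the start and
  \<open>U x l \<le> Psi 1 * \<bar>x\<bar> + sqrt l\<close> (no square root if \<open>l \<le> 0\<close>) at the end, gives the inequality.

  For sharpness, small symmetric steps are followed until \<open>x\<^sup>2 \<ge> l\<close>, and then one jump of size
  \<open>sqrt l\<close> completes the square function exactly without increasing \<open>\<bar>x\<bar>\<close> on average. Along the
  small steps \<open>U\<close> is conserved up to an error that vanishes with the step size.
\<close>

subsection \<open>The heat solution\<close>

definition gauss :: "real \<Rightarrow> real" where
  "gauss y = exp (- y\<^sup>2 / 2)"

definition gauss_int :: "real \<Rightarrow> real" where
  "gauss_int y = (LBINT x=0..y. gauss x)"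

text \<open>\<open>Psi\<close> is not even: for \<open>\<tau> < 0\<close> its integral over \<open>{0..\<tau>}\<close> is \<open>0\<close>. This is the even extension.\<close>

definition Psi_even :: "real \<Rightarrow> real" where
  "Psi_even y = y * gauss_int y + gauss y"

lemma gauss_int_deriv: "(gauss_int has_real_derivative gauss y) (at y)"
proof -
  \<comment> \<open>The interval contains 0 and has \<open>y\<close> in its interior, so the
    derivative within it is the full derivative.\<close>
  have c: "continuous_on {-\<bar>y\<bar>-1..\<bar>y\<bar>+1} gauss"
    unfolding gauss_def by (intro continuous_intros) auto
  have "((\<lambda>u. LBINT x=ereal 0..u. gauss x) has_vector_derivative gauss y) (at y within {-\<bar>y\<bar>-1..\<bar>y\<bar>+1})"
    by (rule interval_integral_FTC2[OF _ _ c]) auto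
  moreover have "at y within {-\<bar>y\<bar>-1..\<bar>y\<bar>+1} = at y"
    by (rule at_within_interior) auto
  ultimately show ?thesis
    unfolding gauss_int_def [abs_def] has_real_derivative_iff_has_vector_derivative
    by (simp add: zero_ereal_def)
qed

lemma gauss_deriv: "(gauss has_real_derivative - y * gauss y) (at y)"
  unfolding gauss_def [abs_def] by (auto intro!: derivative_eq_intros)

lemmas gauss_derivs [derivative_intros] =
  DERIV_chain2[OF gauss_int_deriv] DERIV_chain2[OF gauss_deriv]

text \<open>The terms \<open>y * gauss y\<close> cancel. Hence
  \<open>Psi_even y - y * gauss_int y = gauss y\<close> is also the second derivative, which makes
  \<open>sqrt l * Psi_even (x / sqrt l)\<close> a heat solution.\<close>

lemma Psi_even_deriv: "(Psi_even has_real_derivative gauss_int y) (at y)"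
  unfolding Psi_even_def [abs_def] by (auto intro!: derivative_eq_intros)

lemmas Psi_even_deriv' [derivative_intros] = DERIV_chain2[OF Psi_even_deriv]

lemma gauss_pos [simp]: "0 < gauss y" and gauss_le_1: "gauss y \<le> 1"
  and gauss_minus [simp]: "gauss (- y) = gauss y" and gauss_0 [simp]: "gauss 0 = 1"
  by (auto simp: gauss_def)

lemma gauss_int_0 [simp]: "gauss_int 0 = 0"
  by (simp add: gauss_int_def zero_ereal_def)

lemma gauss_int_minus [simp]: "gauss_int (- y) = - gauss_int y"
proof -
  have "\<forall>z. ((\<lambda>z. gauss_int z + gauss_int (- z)) has_real_derivative 0) (at z)"
    by (auto intro!: derivative_eq_intros)
  from DERIV_isconst_all[OF this, of y 0] show ?thesis by simp
qed

lemma Psi_even_minus [simp]: "Psi_even (- y) = Psi_even y" and Psi_even_0 [simp]: "Psi_even 0 = 1"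
  by (auto simp: Psi_even_def)

lemma Psi_even_abs: "Psi_even \<bar>y\<bar> = Psi_even y"
  by (auto simp: abs_if)

lemma Psi_eq_Psi_even: assumes "0 \<le> y" shows "Psi y = Psi_even y"
proof -
  have c: "continuous_on {0..y} gauss"
    unfolding gauss_def by (intro continuous_intros) auto
  have "gauss_int y = integral {0..y} gauss"
    using interval_integral_eq_integral[of 0 y gauss] borel_integrable_atLeastAtMost'[OF c] assms
    unfolding gauss_int_def by (simp add: zero_ereal_def)
  then show ?thesis by (simp add: Psi_def Psi_even_def gauss_def [abs_def])
qed

lemma gauss_int_nonneg: assumes "0 \<le> y" shows "0 \<le> gauss_int y"
proof -
  have "gauss_int 0 \<le> gauss_int y"
    by (rule DERIV_nonneg_imp_nondecreasing[OF assms]) (use gauss_int_deriv gauss_pos less_imp_le in blast)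
  then show ?thesis by simp
qed

lemma Psi_even_mono: assumes "0 \<le> x" "x \<le> y" shows "Psi_even x \<le> Psi_even y"
  by (rule DERIV_nonneg_imp_nondecreasing[OF assms(2)])
    (use Psi_even_deriv gauss_int_nonneg assms(1) order_trans in blast)

lemma Psi_even_ge_1: "1 \<le> Psi_even y"
  using Psi_even_mono[of 0 "\<bar>y\<bar>"] by (simp add: Psi_even_abs)

section \<open>Concavity and the trapezoidal rule\<close>

lemma concave_nonneg:
  fixes f f' f'' :: "real \<Rightarrow> real"
  assumes "\<And>x. x \<in> {a..b} \<Longrightarrow> (f has_real_derivative f' x) (at x)"
    and "\<And>x. x \<in> {a..b} \<Longrightarrow> (f' has_real_derivative f'' x) (at x)"
    and "\<And>x. x \<in> {a..b} \<Longrightarrow> f'' x \<le> 0"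
    and "0 \<le> f a" "0 \<le> f b" "x \<in> {a..b}"
  shows "0 \<le> f x"
proof -
  have "convex_on {a..b} (\<lambda>x. - f x)"
    by (rule f''_ge0_imp_convex[where f' = "\<lambda>x. - f' x" and f'' = "\<lambda>x. - f'' x"])
      (use assms(1-3) in \<open>auto intro: DERIV_minus\<close>)
  from convex_onD_Icc'[OF this assms(6)] 
  have "- f x \<le> (- f b - - f a) / (b - a) * (x - a) + - f a" .
  show ?thesis
  proof (cases "a = b")
    case True then show ?thesis using assms by auto
  next
    case False
    then have ab: "0 < b - a" using assms(6) by auto
    have "- f x * (b - a) \<le> - f b * (x - a) - f a * (b - x)"
      using \<open>- f x \<le> _\<close> ab by (simp add: field_simps)
    moreover have "0 \<le> f b * (x - a)" "0 \<le> f a * (b - x)" using assms by auto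
    ultimately have "0 \<le> f x * (b - a)" by simp
    with ab show ?thesis by (simp add: zero_le_mult_iff)
  qed
qed

text \<open>Differentiated in its right endpoint, the error is half of
  \<open>f z - f b - (z - b) * f' z\<close>. This is nonnegative by the mean value theorem, because
  \<open>f'\<close> decreases.\<close>

lemma trapezoid_le_integral:
  fixes F f f' :: "real \<Rightarrow> real"
  assumes F: "\<And>x. x \<in> {b..a} \<Longrightarrow> (F has_real_derivative f x) (at x)"
    and f: "\<And>x. x \<in> {b..a} \<Longrightarrow> (f has_real_derivative f' x) (at x)"
    and f': "\<And>x y. b \<le> x \<Longrightarrow> x \<le> y \<Longrightarrow> y \<le> a \<Longrightarrow> f' y \<le> f' x"
    and "b \<le> a"
  shows "(a - b) / 2 * (f a + f b) \<le> F a - F b"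
proof -
  define h where "h z = F z - F b - (z - b) / 2 * (f z + f b)" for z
  have "h b \<le> h a"
  proof (rule DERIV_nonneg_imp_nondecreasing[OF \<open>b \<le> a\<close>])
    fix z assume z: "b \<le> z" "z \<le> a"
    have "(h has_real_derivative (f z - f b - (z - b) * f' z) / 2) (at z)"
      unfolding h_def [abs_def] using z
      by (auto intro!: derivative_eq_intros F f simp: field_simps)
    moreover have "(z - b) * f' z \<le> f z - f b"
    proof (cases "b = z")
      case False
      then obtain w where "b < w" "w < z" "f z - f b = (z - b) * f' w"
        using MVT2[of b z f f'] z f by fastforce
      then show ?thesis using f'[of w z] z by (simp add: mult_left_mono)
    qed auto
    ultimately show "\<exists>y. (h has_real_derivative y) (at z) \<and> 0 \<le> y" by force
  qed
  then show ?thesis by (simp add: h_def)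
qed

text \<open>The second derivative \<open>(y\<^sup>2 - 1) * gauss y\<close> is nonpositive for
  \<open>y\<^sup>2 \<le> 1\<close>, which is the closed parabola in the variable
  \<open>y = x / sqrt l\<close>.\<close>

lemma gauss_trapezoid_le:
  assumes "-1 \<le> b" "b \<le> a" "a \<le> 1"
  shows "(a - b) / 2 * (gauss a + gauss b) \<le> gauss_int a - gauss_int b"
proof (rule trapezoid_le_integral[OF gauss_int_deriv gauss_deriv _ assms(2)])
  fix x y assume xy: "b \<le> x" "x \<le> y" "y \<le> a"
  show "- y * gauss y \<le> - x * gauss x"
  proof (rule DERIV_nonpos_imp_nonincreasing[OF xy(2)])
    fix z assume "x \<le> z" "z \<le> y"
    then have "z\<^sup>2 \<le> 1" using assms xy by (simp add: abs_square_le_1)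
    moreover have "((\<lambda>y. - y * gauss y) has_real_derivative (z\<^sup>2 - 1) * gauss z) (at z)"
      by (auto intro!: derivative_eq_intros simp: algebra_simps power2_eq_square)
    ultimately show "\<exists>w. ((\<lambda>y. - y * gauss y) has_real_derivative w) (at z) \<and> w \<le> 0"
      using less_imp_le[OF gauss_pos[of z]] by (intro exI conjI) (auto simp: mult_le_0_iff)
  qed
qed

text \<open>Here \<open>gauss y + y\<^sup>2 / 2\<close> is convex, since \<open>gauss'' \<ge> -1\<close>.\<close>

lemma gauss_trapezoid_ge:
  assumes "b \<le> a"
  shows "gauss_int a - gauss_int b \<le> (a - b) / 2 * (gauss a + gauss b) + (a - b) ^ 3 / 12"
proof -
  have "(a - b) / 2 * ((- gauss a - a\<^sup>2 / 2) + (- gauss b - b\<^sup>2 / 2))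
      \<le> (- gauss_int a - a ^ 3 / 6) - (- gauss_int b - b ^ 3 / 6)"
  proof (rule trapezoid_le_integral[OF _ _ _ assms])
    show "((\<lambda>x. - gauss_int x - x ^ 3 / 6) has_real_derivative - gauss x - x\<^sup>2 / 2) (at x)" for x
      by (auto intro!: derivative_eq_intros)
    show "((\<lambda>x. - gauss x - x\<^sup>2 / 2) has_real_derivative x * gauss x - x) (at x)" for x
      by (auto intro!: derivative_eq_intros)
    fix x y :: real assume "x \<le> y"
    then show "y * gauss y - y \<le> x * gauss x - x"
    proof (rule DERIV_nonpos_imp_nonincreasing)
      fix z
      have "((\<lambda>y. y * gauss y - y) has_real_derivative (gauss z - 1) - z\<^sup>2 * gauss z) (at z)"
        by (auto intro!: derivative_eq_intros simp: algebra_simps power2_eq_square)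
      moreover have "(gauss z - 1) - z\<^sup>2 * gauss z \<le> 0"
        using gauss_le_1[of z] gauss_pos[of z] by (smt (verit) mult_nonneg_nonneg zero_le_power2)
      ultimately show "\<exists>w. ((\<lambda>y. y * gauss y - y) has_real_derivative w) (at z) \<and> w \<le> 0" by blast
    qed
  qed
  \<comment> \<open>The trapezoidal error of \<open>x\<^sup>2 / 2\<close> on \<open>{b..a}\<close>
    is exactly \<open>(a - b) ^ 3 / 12\<close>.\<close>
  moreover have "(a - b) / 2 * ((- gauss a - a\<^sup>2 / 2) + (- gauss b - b\<^sup>2 / 2))
      - (- (a ^ 3 / 6) + b ^ 3 / 6) = - ((a - b) / 2 * (gauss a + gauss b) + (a - b) ^ 3 / 12)"
    by (simp add: field_simps power2_eq_square power3_eq_cube)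
  ultimately show ?thesis by linarith
qed

section \<open>Symmetric steps of the heat solution\<close>

lemma heat_deriv:
  assumes "r\<^sup>2 < l"
  shows "((\<lambda>r. sqrt (l - r\<^sup>2) * Psi_even ((x + r) / sqrt (l - r\<^sup>2))) has_real_derivative
    gauss_int ((x + r) / sqrt (l - r\<^sup>2)) - r / sqrt (l - r\<^sup>2) * gauss ((x + r) / sqrt (l - r\<^sup>2))) (at r)"
proof -
  define s where "s = sqrt (l - r\<^sup>2)"
  have s: "0 < s" "l - r\<^sup>2 = s\<^sup>2" using assms by (auto simp: s_def)
  have ds: "((\<lambda>r. sqrt (l - r\<^sup>2)) has_real_derivative - r / s) (at r)"
    using assms unfolding s_def by (auto intro!: derivative_eq_intros simp: field_simps)
  show ?thesis
    unfolding s_def[symmetric]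
    by (rule derivative_eq_intros ds refl | (use s in \<open>simp add: s_def[symmetric]; fail\<close>))+
      (use s in \<open>simp add: s_def[symmetric] Psi_even_def field_simps power2_eq_square\<close>)
qed

text \<open>By the heat equation, the derivative in the step size is the error of the trapezoidal rule
  for \<open>gauss\<close>.\<close>

lemma heat_step_deriv:
  fixes x l r :: real
  assumes "r\<^sup>2 < l"
  defines "s \<equiv> sqrt (l - r\<^sup>2)"
  shows "((\<lambda>r. sqrt (l - r\<^sup>2) * (Psi_even ((x + r) / sqrt (l - r\<^sup>2)) + Psi_even ((x - r) / sqrt (l - r\<^sup>2))))
    has_real_derivative gauss_int ((x + r) / s) - gauss_int ((x - r) / s)
      - ((x + r) / s - (x - r) / s) / 2 * (gauss ((x + r) / s) + gauss ((x - r) / s))) (at r)"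
proof -
  have e: "(- x + q) / w = - ((x - q) / w)" for q w :: real by (simp add: minus_divide_left)
  \<comment> \<open>The branch \<open>x - r\<close> is the reflection of \<open>- x + r\<close>, so
    it is covered by \<open>heat_deriv\<close> at \<open>- x\<close> and parity.\<close>
  have "((\<lambda>r. sqrt (l - r\<^sup>2) * Psi_even ((x + r) / sqrt (l - r\<^sup>2)) +
      sqrt (l - r\<^sup>2) * Psi_even ((- x + r) / sqrt (l - r\<^sup>2))) has_real_derivative
      (gauss_int ((x + r) / s) - r / s * gauss ((x + r) / s)) +
      (gauss_int ((- x + r) / s) - r / s * gauss ((- x + r) / s))) (at r)"
    unfolding s_def by (intro DERIV_add heat_deriv assms)
  then have "((\<lambda>r. sqrt (l - r\<^sup>2) * (Psi_even ((x + r) / sqrt (l - r\<^sup>2)) + Psi_even ((x - r) / sqrt (l - r\<^sup>2))))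
    has_real_derivative (gauss_int ((x + r) / s) - r / s * gauss ((x + r) / s)) +
      (- gauss_int ((x - r) / s) - r / s * gauss ((x - r) / s))) (at r)"
    unfolding e gauss_int_minus gauss_minus Psi_even_minus by (simp add: distrib_left)
  moreover have "((x + r) / s - (x - r) / s) / 2 = r / s"
    by (simp add: diff_divide_distrib[symmetric])
  ultimately show ?thesis by (simp add: algebra_simps)
qed

text \<open>As \<open>r\<close> grows to \<open>d\<close>, \<open>\<bar>x\<bar> + r\<close> grows
  and \<open>sqrt (l - r\<^sup>2)\<close> shrinks, so the condition at \<open>d\<close> keeps both
  ends in the closed parabola throughout. There the derivative in \<open>r\<close> is
  nonnegative.\<close>

lemma heat_step_lower:
  fixes x d l :: real
  assumes d: "0 \<le> d" and l: "d\<^sup>2 < l" and x: "\<bar>x\<bar> + d \<le> sqrt (l - d\<^sup>2)"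
  shows "2 * (sqrt l * Psi_even (x / sqrt l)) \<le> sqrt (l - d\<^sup>2) *
    (Psi_even ((x + d) / sqrt (l - d\<^sup>2)) + Psi_even ((x - d) / sqrt (l - d\<^sup>2)))" (is "_ \<le> ?f d")
proof -
  have "?f 0 \<le> ?f d"
  proof (rule DERIV_nonneg_imp_nondecreasing[OF d])
    fix r assume r: "0 \<le> r" "r \<le> d"
    then have r2: "r\<^sup>2 \<le> d\<^sup>2" by (simp add: power_mono)
    define s where "s = sqrt (l - r\<^sup>2)"
    have s0: "0 < s" and "sqrt (l - d\<^sup>2) \<le> s" using r2 l by (auto simp: s_def)
    then have s: "\<bar>x\<bar> + r \<le> s" using x r by linarith
    have "((x + r) / s - (x - r) / s) / 2 * (gauss ((x + r) / s) + gauss ((x - r) / s))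
      \<le> gauss_int ((x + r) / s) - gauss_int ((x - r) / s)"
      by (rule gauss_trapezoid_le) (use s s0 r in \<open>auto simp: field_simps\<close>)
    moreover have "r\<^sup>2 < l" using r2 l by simp
    ultimately show "\<exists>y. (?f has_real_derivative y) (at r) \<and> 0 \<le> y"
      using heat_step_deriv[of r l x] unfolding s_def by (intro exI conjI) auto
  qed
  then show ?thesis by simp
qed

text \<open>The bound in \<open>gauss_trapezoid_ge\<close> has no range restriction, so
  \<open>x\<close> is arbitrary. For \<open>d = 1\<close> the error is of order
  \<open>(l - 1) powr (- 3 / 2)\<close>, summable over integers \<open>l > 1\<close>.\<close>

lemma heat_step_upper:
  fixes x l d :: real
  assumes d: "0 \<le> d" and l: "d\<^sup>2 < l"
  shows "sqrt (l - d\<^sup>2) * (Psi_even ((x + d) / sqrt (l - d\<^sup>2)) + Psi_even ((x - d) / sqrt (l - d\<^sup>2)))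
    \<le> 2 * (sqrt l * Psi_even (x / sqrt l)) + 2 * d ^ 4 / (3 * sqrt (l - d\<^sup>2) ^ 3)" (is "?f d \<le> _")
proof -
  \<comment> \<open>\<open>c\<close> bounds \<open>2 * r ^ 3 / (3 * s ^ 3)\<close> for all
    \<open>r \<le> d\<close>, the worst case being \<open>r = d\<close>.\<close>
  define c where "c = 2 * d ^ 3 / (3 * sqrt (l - d\<^sup>2) ^ 3)"
  have "?f d - c * d \<le> ?f 0 - c * 0"
  proof (rule DERIV_nonpos_imp_nonincreasing[OF d])
    fix r assume r: "0 \<le> r" "r \<le> d"
    then have r2: "r\<^sup>2 \<le> d\<^sup>2" by (simp add: power_mono)
    define s where "s = sqrt (l - r\<^sup>2)"
    have s0: "0 < s" and s: "sqrt (l - d\<^sup>2) \<le> s" using r2 l by (auto simp: s_def)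
    have "gauss_int ((x + r) / s) - gauss_int ((x - r) / s) \<le>
        ((x + r) / s - (x - r) / s) / 2 * (gauss ((x + r) / s) + gauss ((x - r) / s))
        + ((x + r) / s - (x - r) / s) ^ 3 / 12"
      by (rule gauss_trapezoid_ge) (use s0 r in \<open>auto simp: field_simps\<close>)
    moreover have "((x + r) / s - (x - r) / s) ^ 3 / 12 = 2 * r ^ 3 / (3 * s ^ 3)"
      by (simp add: diff_divide_distrib[symmetric] power_divide power_mult_distrib)
    moreover have "\<dots> \<le> c"
      unfolding c_def by (intro frac_le) (use l r s in \<open>auto intro!: power_mono mult_nonneg_nonneg\<close>)
    moreover have "r\<^sup>2 < l" using r2 l by simp
    moreover have "((\<lambda>r. c * r) has_real_derivative c) (at r)"
      by (auto intro!: derivative_eq_intros)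
    ultimately show "\<exists>y. ((\<lambda>r. ?f r - c * r) has_real_derivative y) (at r) \<and> y \<le> 0"
      using DERIV_diff[OF heat_step_deriv[of r l x], of "\<lambda>r. c * r" c]
      unfolding s_def by (intro exI conjI) auto
  qed
  moreover have "c * d = 2 * d ^ 4 / (3 * sqrt (l - d\<^sup>2) ^ 3)"
    by (simp add: c_def power3_eq_cube power4_eq_xxxx)
  ultimately show ?thesis by simp
qed

section \<open>Taylor bounds and comparison with linear functions\<close>

lemma le_by_deriv_le:
  fixes f h f' h' :: "real \<Rightarrow> real"
  assumes "\<And>x. 0 \<le> x \<Longrightarrow> (f has_real_derivative f' x) (at x)"
    and "\<And>x. 0 \<le> x \<Longrightarrow> (h has_real_derivative h' x) (at x)"
    and "\<And>x. 0 \<le> x \<Longrightarrow> f' x \<le> h' x" and "f 0 \<le> h 0" and "0 \<le> x"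
  shows "f x \<le> h x"
proof -
  have "h 0 - f 0 \<le> h x - f x"
  proof (rule DERIV_nonneg_imp_nondecreasing[OF \<open>0 \<le> x\<close>])
    fix z :: real assume "0 \<le> z"
    then show "\<exists>y. ((\<lambda>z. h z - f z) has_real_derivative y) (at z) \<and> 0 \<le> y"
      using assms(1-3)[of z] by (intro exI[of _ "h' z - f' z"]) (auto intro: DERIV_diff)
  qed
  with assms(4) show ?thesis by simp
qed

text \<open>Bootstrapping from \<open>gauss x \<le> 1\<close>: a bound inserted into the derivative
  \<open>- x * gauss x\<close> and integrated gives the next bound, in the opposite
  direction.\<close>

lemma gauss_taylor:
  assumes "0 \<le> x"
  shows "1 - x\<^sup>2 / 2 \<le> gauss x" and "gauss x \<le> 1 - x\<^sup>2 / 2 + x ^ 4 / 8"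
proof -
  have lo: "1 - x\<^sup>2 / 2 \<le> gauss x" if "0 \<le> x" for x
  proof (rule le_by_deriv_le[OF _ gauss_deriv _ _ that])
    show "((\<lambda>x. 1 - x\<^sup>2 / 2) has_real_derivative - z) (at z)" for z :: real
      by (auto intro!: derivative_eq_intros)
    show "- z \<le> - z * gauss z" if "0 \<le> z" for z
      using that gauss_le_1[of z] by (simp add: mult_left_le)
  qed auto
  show "1 - x\<^sup>2 / 2 \<le> gauss x" using lo[OF assms] .
  show "gauss x \<le> 1 - x\<^sup>2 / 2 + x ^ 4 / 8"
  proof (rule le_by_deriv_le[OF gauss_deriv _ _ _ assms])
    show "((\<lambda>x. 1 - x\<^sup>2 / 2 + x ^ 4 / 8) has_real_derivative - z + z ^ 3 / 2) (at z)" for z :: real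
      by (auto intro!: derivative_eq_intros)
    show "- z * gauss z \<le> - z + z ^ 3 / 2" if "0 \<le> z" for z
      using mult_left_mono[OF lo[OF that] that]
      by (simp add: algebra_simps power2_eq_square power3_eq_cube)
  qed auto
qed

lemma gauss_int_taylor:
  assumes "0 \<le> x"
  shows "gauss_int x \<le> x" and "x - x ^ 3 / 6 \<le> gauss_int x"
    and "gauss_int x \<le> x - x ^ 3 / 6 + x ^ 5 / 40"
proof -
  show "gauss_int x \<le> x"
    by (rule le_by_deriv_le[OF gauss_int_deriv DERIV_ident gauss_le_1 _ assms]) auto
  show "x - x ^ 3 / 6 \<le> gauss_int x"
    by (rule le_by_deriv_le[OF _ gauss_int_deriv gauss_taylor(1) _ assms])
      (auto intro!: derivative_eq_intros)
  show "gauss_int x \<le> x - x ^ 3 / 6 + x ^ 5 / 40"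
    by (rule le_by_deriv_le[OF gauss_int_deriv _ gauss_taylor(2) _ assms])
      (auto intro!: derivative_eq_intros)
qed

lemma Psi_even_taylor:
  assumes "0 \<le> x"
  shows "Psi_even x \<le> 1 + x\<^sup>2 / 2" and "1 + x\<^sup>2 / 2 - x ^ 4 / 24 \<le> Psi_even x"
    and "Psi_even x \<le> 1 + x\<^sup>2 / 2 - x ^ 4 / 24 + x ^ 6 / 240"
proof -
  show "Psi_even x \<le> 1 + x\<^sup>2 / 2"
    by (rule le_by_deriv_le[OF Psi_even_deriv _ gauss_int_taylor(1) _ assms])
      (auto intro!: derivative_eq_intros)
  show "1 + x\<^sup>2 / 2 - x ^ 4 / 24 \<le> Psi_even x"
    by (rule le_by_deriv_le[OF _ Psi_even_deriv gauss_int_taylor(2) _ assms])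
      (auto intro!: derivative_eq_intros)
  show "Psi_even x \<le> 1 + x\<^sup>2 / 2 - x ^ 4 / 24 + x ^ 6 / 240"
    by (rule le_by_deriv_le[OF Psi_even_deriv _ gauss_int_taylor(3) _ assms])
      (auto intro!: derivative_eq_intros)
qed

text \<open>The Taylor bounds at 1 are \<open>1 + 1/2 - 1/24\<close>, here rounded down, and
  \<open>1 + 1/2 - 1/24 + 1/240\<close>.\<close>

lemma Psi_1_bounds: "14583 / 10000 \<le> Psi 1" "Psi 1 \<le> 14625 / 10000"
  using Psi_even_taylor(2,3)[of 1] by (auto simp: Psi_eq_Psi_even)

text \<open>\<open>Psi_even\<close> is convex, since its second derivative is
  \<open>gauss\<close>.\<close>

lemma Psi_even_le_linear:
  assumes "Psi_even a \<le> c + m * a" "Psi_even b \<le> c + m * b" "x \<in> {a..b}"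
  shows "Psi_even x \<le> c + m * x"
proof -
  have "0 \<le> c + m * x - Psi_even x"
    by (rule concave_nonneg[of a b "\<lambda>x. c + m * x - Psi_even x" "\<lambda>x. m - gauss_int x" "\<lambda>x. - gauss x"])
      (use assms in \<open>auto intro!: derivative_eq_intros simp: less_imp_le\<close>)
  then show ?thesis by simp
qed

text \<open>On \<open>{0..1}\<close> the difference \<open>Psi_even z - Psi 1 * z\<close> decreases,
  because its slope is at most \<open>1 - Psi 1\<close>, and it vanishes at 1.\<close>

lemma Psi_even_ge_linear:
  assumes "\<bar>x\<bar> \<le> 1"
  shows "Psi 1 * \<bar>x\<bar> \<le> Psi_even x"
proof -
  have "Psi_even 1 - Psi 1 * 1 \<le> Psi_even \<bar>x\<bar> - Psi 1 * \<bar>x\<bar>"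
  proof (rule DERIV_nonpos_imp_nonincreasing[OF assms])
    fix z assume "\<bar>x\<bar> \<le> z" "z \<le> 1"
    then have "gauss_int z - Psi 1 \<le> 0"
      using gauss_int_taylor(1)[of z] Psi_1_bounds by linarith
    moreover have "((\<lambda>z. Psi_even z - Psi 1 * z) has_real_derivative gauss_int z - Psi 1) (at z)"
      by (auto intro!: derivative_eq_intros)
    ultimately show "\<exists>y. ((\<lambda>z. Psi_even z - Psi 1 * z) has_real_derivative y) (at z) \<and> y \<le> 0" by blast
  qed
  then show ?thesis by (simp add: Psi_eq_Psi_even Psi_even_abs)
qed

lemma scaled_Psi_even_ge:
  assumes "0 < s" "\<bar>x\<bar> \<le> s"
  shows "Psi 1 * \<bar>x\<bar> \<le> s * Psi_even (x / s)"
proof -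
  have "Psi 1 * \<bar>x / s\<bar> \<le> Psi_even (x / s)"
    by (rule Psi_even_ge_linear) (use assms in auto)
  from mult_left_mono[OF this, of s] show ?thesis using assms by simp
qed

subsection \<open>One step of size \<open>d\<close> that leaves the parabola on one side only\<close>

text \<open>For \<open>d\<^sup>2 \<le> 1/2\<close> the difference of the two sides is concave in \<open>x\<close> (for \<open>d \<ge> 3/5\<close> only up to
  \<open>x = 1/2\<close>), and at \<open>x = s - d\<close> it is covered by \<open>heat_step_lower\<close>. In the remaining range the
  crude bounds \<open>Psi_even y \<ge> 1\<close> and \<open>Psi_even y \<ge> Psi 1 * \<bar>y\<bar>\<close> suffice.\<close>

lemma mixed_step_concave:
  fixes d x b :: real
  defines "s \<equiv> sqrt (1 - d\<^sup>2)"
  assumes d: "0 \<le> d" "d \<le> s" "0 < s"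
    and conc: "\<And>z. z \<in> {s - d..b} \<Longrightarrow> gauss ((z - d) / s) \<le> 2 * s * gauss z"
    and b: "2 * Psi_even b \<le> Psi 1 * (b + d) + s * Psi_even ((b - d) / s)"
    and x: "x \<in> {s - d..b}"
  shows "2 * Psi_even x \<le> Psi 1 * (x + d) + s * Psi_even ((x - d) / s)"
proof -
  have s2: "d\<^sup>2 < 1" using d by (simp add: s_def)
  \<comment> \<open>At \<open>x = s - d\<close> the outer end is \<open>s\<close>, on the parabola
    itself, where \<open>Psi 1 * s\<close> and \<open>s * Psi_even (s / s)\<close> agree.\<close>
  have a: "2 * Psi_even (s - d) \<le> Psi 1 * (s - d + d) + s * Psi_even ((s - d - d) / s)"
    using heat_step_lower[of d 1 "s - d"] d s2 unfolding s_def[symmetric]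
    by (simp add: Psi_eq_Psi_even distrib_left mult.commute)
  have "0 \<le> Psi 1 * (x + d) + s * Psi_even ((x - d) / s) - 2 * Psi_even x"
    by (rule concave_nonneg[of "s - d" b "\<lambda>x. Psi 1 * (x + d) + s * Psi_even ((x - d) / s) - 2 * Psi_even x"
          "\<lambda>x. Psi 1 + gauss_int ((x - d) / s) - 2 * gauss_int x"
          "\<lambda>x. gauss ((x - d) / s) / s - 2 * gauss x"])
      (use a b x d conc in \<open>auto intro!: derivative_eq_intros simp: field_simps\<close>)
  then show ?thesis by simp
qed

lemma mixed_step_at_1:
  assumes "0 < s" "1 - d \<le> s" "d \<le> 1"
  shows "2 * Psi_even 1 \<le> Psi 1 * (1 + d) + s * Psi_even ((1 - d) / s)"
proof -
  have "Psi 1 * \<bar>1 - d\<bar> \<le> s * Psi_even ((1 - d) / s)"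
    by (rule scaled_Psi_even_ge) (use assms in auto)
  then show ?thesis using assms(3) by (simp add: Psi_eq_Psi_even algebra_simps)
qed

lemma mixed_step_small:
  fixes d x :: real
  defines "s \<equiv> sqrt (1 - d\<^sup>2)"
  assumes d: "0 \<le> d" "d \<le> 3 / 5" and x: "s - d \<le> x" "x \<le> 1"
  shows "2 * Psi_even x \<le> Psi 1 * (x + d) + s * Psi_even ((x - d) / s)"
proof -
  have d2: "d\<^sup>2 \<le> (3 / 5)\<^sup>2" using d by (intro power_mono) auto
  have s: "4 / 5 \<le> s"
    unfolding s_def by (rule real_le_rsqrt) (use d2 in \<open>simp add: power2_eq_square\<close>)
  have s2: "s\<^sup>2 = 1 - d\<^sup>2" using d2 by (simp add: s_def power2_eq_square)
  show ?thesis unfolding s_def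
  proof (rule mixed_step_concave[where b = 1], unfold s_def[symmetric])
    fix z assume z: "z \<in> {s - d..1}"
    \<comment> \<open>The goal amounts to
      \<open>exp (z\<^sup>2 / 2 - ((z - d) / s)\<^sup>2 / 2) \<le> 2 * s\<close>. Since
      \<open>z\<^sup>2 * s\<^sup>2 - (z - d)\<^sup>2 = 1 - d\<^sup>2 - (1 - z * d)\<^sup>2\<close>,
      the worst case is \<open>z = 1\<close>, with exponent \<open>d / (1 + d)\<close>.\<close>
    have "z * d \<le> d" using z d by (auto simp: mult_left_le_one_le mult_le_cancel_right2)
    then have "(1 - d)\<^sup>2 \<le> (1 - z * d)\<^sup>2" using d by (intro power_mono) auto
    then have "z\<^sup>2 * s\<^sup>2 - (z - d)\<^sup>2 \<le> 2 * (d * (1 - d))"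
      unfolding s2 by (simp add: power2_eq_square algebra_simps)
    also have "d * (1 - d) = d / (1 + d) * s\<^sup>2"
      using d unfolding s2 by (simp add: field_simps power2_eq_square)
    finally have "z\<^sup>2 * s\<^sup>2 - (z - d)\<^sup>2 \<le> 2 * (d / (1 + d) * s\<^sup>2)" .
    then have "z\<^sup>2 / 2 - ((z - d) / s)\<^sup>2 / 2 \<le> d / (1 + d)"
      using s by (simp add: field_simps power_divide)
    also have "\<dots> \<le> 3 / 8" using d by (simp add: field_simps)
    finally have "exp (z\<^sup>2 / 2 - ((z - d) / s)\<^sup>2 / 2) \<le> exp (3 / 8)" by simp
    also have "\<dots> \<le> 8 / 5" using exp_bound[of "3 / 8"] by (simp add: power2_eq_square)
    also have "\<dots> \<le> 2 * s" using s by simp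
    finally have "exp (z\<^sup>2 / 2 - ((z - d) / s)\<^sup>2 / 2) * gauss z \<le> 2 * s * gauss z"
      by (intro mult_right_mono) (auto simp: less_imp_le)
    then show "gauss ((z - d) / s) \<le> 2 * s * gauss z"
      by (simp add: gauss_def exp_add[symmetric])
  next
    have "1 - d \<le> s"
      unfolding s_def by (rule real_le_rsqrt) (use d in \<open>auto simp: power2_eq_square algebra_simps mult_left_le\<close>)
    then show "2 * Psi_even 1 \<le> Psi 1 * (1 + d) + s * Psi_even ((1 - d) / s)"
      by (intro mixed_step_at_1) (use s d in auto)
  qed (use d s x in auto)
qed

text \<open>For \<open>x \<ge> 1 / 2\<close> the inner term is bounded below by \<open>s\<close>; by
  convexity it is then enough to check \<open>1 / 2\<close> and 1. The result at
  \<open>1 / 2\<close> is the endpoint condition for the concavity argument on the left.\<close>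

lemma mixed_step_medium:
  fixes d x :: real
  defines "s \<equiv> sqrt (1 - d\<^sup>2)"
  assumes d: "3 / 5 \<le> d" "d\<^sup>2 \<le> 1 / 2" and x: "s - d \<le> x" "x \<le> 1"
  shows "2 * Psi_even x \<le> Psi 1 * (x + d) + s * Psi_even ((x - d) / s)"
proof -
  have s: "7 / 10 \<le> s"
    unfolding s_def by (rule real_le_rsqrt) (use d in \<open>simp add: power2_eq_square\<close>)
  have ds: "d \<le> s" unfolding s_def by (rule real_le_rsqrt) (use d in auto)
  have dx: "d \<le> 3 / 4" by (rule power2_le_imp_le) (use d in \<open>auto simp: power2_eq_square\<close>)
  have *: "2 * Psi_even z \<le> Psi 1 * (z + d) + s * Psi_even ((z - d) / s)" if z: "1 / 2 \<le> z" "z \<le> 1" for z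
  proof -
    have "Psi_even z \<le> (Psi 1 * d + s) / 2 + Psi 1 / 2 * z"
    proof (rule Psi_even_le_linear[of "1 / 2" _ _ 1])
      have "14583 / 10000 * (1 / 2 + 3 / 5) \<le> Psi 1 * (1 / 2 + d)"
        by (intro mult_mono) (use Psi_1_bounds d in auto)
      then show "Psi_even (1 / 2) \<le> (Psi 1 * d + s) / 2 + Psi 1 / 2 * (1 / 2)"
        using Psi_even_taylor(1)[of "1 / 2"] s by (simp add: power2_eq_square distrib_left add_divide_distrib mult.commute)
      have "Psi 1 * (1 - d) \<le> 14625 / 10000 * (2 / 5)"
        by (intro mult_mono) (use Psi_1_bounds d dx in auto)
      then show "Psi_even 1 \<le> (Psi 1 * d + s) / 2 + Psi 1 / 2 * 1"
        using s by (simp add: Psi_eq_Psi_even right_diff_distrib add_divide_distrib mult.commute)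
    qed (use z in auto)
    moreover have "s * 1 \<le> s * Psi_even ((z - d) / s)"
      using s Psi_even_ge_1 by (intro mult_left_mono) auto
    ultimately show ?thesis by (simp add: field_simps)
  qed
  show ?thesis
  proof (cases "1 / 2 \<le> x")
    case False
    show ?thesis unfolding s_def
    proof (rule mixed_step_concave[where b = "1 / 2"], unfold s_def[symmetric])
      fix z assume z: "z \<in> {s - d..1 / 2}"
      then have "z\<^sup>2 \<le> (1 / 2)\<^sup>2" using ds by (intro power_mono) auto
      then have "7 / 8 \<le> gauss z" using gauss_taylor(1)[of z] z ds by (simp add: power2_eq_square)
      then have "2 * (7 / 10) * (7 / 8) \<le> 2 * s * gauss z" using s by (intro mult_mono) auto
      then show "gauss ((z - d) / s) \<le> 2 * s * gauss z"
        using gauss_le_1[of "(z - d) / s"] by simp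
    qed (use d s ds x False * in auto)
  qed (use * x in auto)
qed

text \<open>The sharp constant here is \<open>1 + sqrt 2\<close>, slightly more than \<open>12 / 5\<close>.\<close>

lemma half_circle_ge:
  fixes d :: real
  assumes "0 \<le> d" "d \<le> 1" "1 / 2 \<le> d\<^sup>2"
  shows "12 / 5 * (1 - d) \<le> sqrt (1 - d\<^sup>2)" and "7071 / 10000 \<le> d"
proof -
  show d: "7071 / 10000 \<le> d"
    by (rule power2_le_imp_le) (use assms in \<open>auto simp: power2_eq_square\<close>)
  have "(12 / 5)\<^sup>2 * (1 - d) * (1 - d) \<le> (1 + d) * (1 - d)"
    using assms d by (intro mult_right_mono) (auto simp: power2_eq_square)
  then show "12 / 5 * (1 - d) \<le> sqrt (1 - d\<^sup>2)"
    by (intro real_le_rsqrt) (simp add: power2_eq_square algebra_simps)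
qed

text \<open>The linear bound on the inner term makes the right side at least
  \<open>2 * Psi 1 * d\<close>. Where that is too small, \<open>x\<close> is bounded away from 0,
  and a line above \<open>Psi_even\<close> together with the inner bound \<open>s\<close>
  suffices.\<close>

lemma mixed_step_large:
  fixes d x :: real
  defines "s \<equiv> sqrt (1 - d\<^sup>2)"
  assumes d: "0 \<le> d" "d < 1" "1 / 2 \<le> d\<^sup>2" and x: "0 \<le> x" "d - s \<le> x" "x \<le> 1"
  shows "2 * Psi_even x \<le> Psi 1 * (x + d) + s * Psi_even ((x - d) / s)"
proof -
  have s: "12 / 5 * (1 - d) \<le> s" and dl: "7071 / 10000 \<le> d" using half_circle_ge[of d] d unfolding s_def by auto
  have s0: "0 < s" using s d by auto
  have k: "14583 / 10000 \<le> Psi 1" "Psi 1 \<le> 14625 / 10000" by (rule Psi_1_bounds)+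
  show ?thesis
  proof (cases "Psi_even x \<le> Psi 1 * d")
    case True
    have "x \<le> s + d"
    proof -
      have "1 - d \<le> s" using s d by auto
      then show ?thesis using x by simp
    qed
    then have "Psi 1 * \<bar>x - d\<bar> \<le> s * Psi_even ((x - d) / s)"
      using s0 x by (intro scaled_Psi_even_ge) auto
    moreover have "Psi 1 * (d - x) \<le> Psi 1 * \<bar>x - d\<bar>"
      using k by (intro mult_left_mono) auto
    ultimately show ?thesis using True by (simp add: algebra_simps)
  next
    case False
    \<comment> \<open>\<open>Psi 1 * d\<close> exceeds 1.031, whereas
      \<open>Psi_even (23 / 100)\<close> is below 1.027; hence \<open>x\<close> exceeds
      \<open>23 / 100\<close>.\<close>
    have kd: "14583 / 10000 * (7071 / 10000) \<le> Psi 1 * d" using k dl by (intro mult_mono) auto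
    have P23: "Psi_even (23 / 100) \<le> 1 + (23 / 100)\<^sup>2 / 2" by (rule Psi_even_taylor) auto
    have x23: "23 / 100 \<le> x"
    proof (rule ccontr)
      assume "\<not> ?thesis"
      then have "Psi_even x \<le> Psi_even (23 / 100)" using x by (intro Psi_even_mono) auto
      with False kd P23 show False by (simp add: power2_eq_square)
    qed
    \<comment> \<open>The line of slope \<open>56 / 100\<close> through the point
      \<open>(1, Psi 1)\<close> still lies above \<open>Psi_even\<close> at
      \<open>23 / 100\<close>.\<close>
    have "Psi_even x \<le> (Psi 1 - 56 / 100) + 56 / 100 * x"
      by (rule Psi_even_le_linear[of "23 / 100" _ _ 1])
        (use P23 k x x23 in \<open>auto simp: power2_eq_square Psi_eq_Psi_even\<close>)
    then have q: "1 - x \<le> (Psi 1 - Psi_even x) / (56 / 100)" by simp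
    have "Psi 1 * (1 - x) \<le> 14625 / 10000 * ((Psi 1 - Psi_even x) / (56 / 100))"
      by (rule mult_mono) (use q k x in auto)
    then have "Psi 1 - Psi 1 * x \<le> 585 / 224 * (Psi 1 - Psi_even x)"
      by (simp add: right_diff_distrib)
    moreover have "Psi 1 * (1 - d) \<le> 14625 / 10000 * (1 - d)"
      by (rule mult_right_mono) (use k d in auto)
    then have "Psi 1 - Psi 1 * d \<le> 14625 / 10000 * (1 - d)"
      by (simp add: right_diff_distrib)
    moreover have "s * 1 \<le> s * Psi_even ((x - d) / s)"
      using s0 Psi_even_ge_1 by (intro mult_left_mono) auto
    moreover have "Psi 1 - Psi_even x \<le> Psi 1 - Psi 1 * d" using False by simp
    \<comment> \<open>The excess over the factor 2 is at most
      \<open>137 / 224 * (Psi 1 - Psi 1 * d)\<close>. Adding \<open>Psi 1 - Psi 1 * d\<close> gives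
      less than \<open>12 / 5 * (1 - d)\<close>, hence less than \<open>s\<close>.\<close>
    moreover have "585 / 224 * (Psi 1 - Psi_even x) = 2 * (Psi 1 - Psi_even x) + 137 / 224 * (Psi 1 - Psi_even x)"
      by (simp add: field_simps)
    ultimately have "2 * Psi_even x \<le> Psi 1 * x + Psi 1 * d + s * Psi_even ((x - d) / s)"
      using s d by argo
    then show ?thesis by (simp add: distrib_left)
  qed
qed

lemma mixed_step:
  fixes d x :: real
  defines "s \<equiv> sqrt (1 - d\<^sup>2)"
  assumes "0 \<le> d" "d < 1" "0 \<le> x" "x \<le> 1" "s - d \<le> x" "d - s \<le> x"
  shows "2 * Psi_even x \<le> Psi 1 * (x + d) + s * Psi_even ((x - d) / s)"
proof -
  consider "d \<le> 3 / 5" | "3 / 5 \<le> d" "d\<^sup>2 \<le> 1 / 2" | "1 / 2 \<le> d\<^sup>2" by linarith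
  then show ?thesis
    using assms mixed_step_small[of d x] mixed_step_medium[of d x] mixed_step_large[of d x] by cases auto
qed

text \<open>With both ends outside, the right side of the step is
  \<open>Psi 1 * (x + d) + Psi 1 * (d - x)\<close>, twice the bound here. The chord of
  \<open>Psi_even\<close> on \<open>{0..1}\<close> reduces the claim to
  \<open>1 - d \<le> (Psi 1 - 1) * s\<close>.\<close>

lemma outer_step:
  fixes d x :: real
  assumes d: "0 \<le> d" "d < 1" and x: "0 \<le> x" "x \<le> d - sqrt (1 - d\<^sup>2)"
  shows "Psi_even x \<le> Psi 1 * d"
proof -
  define s where "s = sqrt (1 - d\<^sup>2)"
  have "s \<le> d" using x by (simp add: s_def)
  then have "s\<^sup>2 \<le> d\<^sup>2" using d by (intro power_mono) (auto simp: s_def power_le_one)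
  then have "1 / 2 \<le> d\<^sup>2" using d by (simp add: s_def power_le_one)
  then have s: "12 / 5 * (1 - d) \<le> s" using half_circle_ge[of d] d unfolding s_def by auto
  have "Psi_even x \<le> 1 + (Psi 1 - 1) * x"
    by (rule Psi_even_le_linear[of 0 _ _ 1]) (use x d s in \<open>auto simp: Psi_eq_Psi_even s_def\<close>)
  also have "\<dots> \<le> 1 + (Psi 1 - 1) * (d - s)"
    using Psi_1_bounds x by (auto simp: s_def intro!: mult_left_mono)
  also have "\<dots> \<le> Psi 1 * d"
  proof -
    have "5 / 12 * s \<le> (Psi 1 - 1) * s" using Psi_1_bounds s d by (intro mult_right_mono) auto
    then show ?thesis using s by (simp add: algebra_simps)
  qed
  finally show ?thesis .
qed

subsection \<open>The barrier function\<close>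

text \<open>Both formulas agree on the parabola when \<open>l > 0\<close>. For
  \<open>l \<le> 0\<close>, when the square function is complete, only the multiple of
  \<open>\<bar>x\<bar>\<close> remains.\<close>

definition barrier :: "real \<Rightarrow> real \<Rightarrow> real" where
  "barrier x l = (if x\<^sup>2 < l then sqrt l * Psi_even (x / sqrt l) else Psi 1 * \<bar>x\<bar>)"

lemma barrier_minus [simp]: "barrier (- x) l = barrier x l"
  by (simp add: barrier_def)

lemma square_less_iff_abs_less_sqrt: "x\<^sup>2 < l \<longleftrightarrow> \<bar>x\<bar> < sqrt l" for x l :: real
  by (metis real_sqrt_abs real_sqrt_less_iff)

lemma barrier_ge: "Psi 1 * \<bar>x\<bar> \<le> barrier x l"
proof (cases "x\<^sup>2 < l")
  case True
  then have "0 < l" by (meson le_less_trans zero_le_power2)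
  with True show ?thesis using scaled_Psi_even_ge[of "sqrt l" x]
    by (auto simp: barrier_def square_less_iff_abs_less_sqrt)
qed (simp add: barrier_def)

lemma barrier_ge_sqrt: assumes "0 \<le> l" shows "sqrt l \<le> barrier x l"
proof (cases "x\<^sup>2 < l")
  case True
  have "sqrt l * 1 \<le> sqrt l * Psi_even (x / sqrt l)"
    using assms Psi_even_ge_1 by (intro mult_left_mono) auto
  with True show ?thesis by (simp add: barrier_def)
next
  case False
  then have "sqrt l \<le> \<bar>x\<bar>" by (simp add: square_less_iff_abs_less_sqrt)
  also have "\<dots> \<le> Psi 1 * \<bar>x\<bar>" using Psi_1_bounds by (simp add: mult_le_cancel_right1)
  finally show ?thesis using barrier_ge order_trans by blast
qed

lemma barrier_le: "barrier x l \<le> Psi 1 * \<bar>x\<bar> + (if 0 < l then sqrt l else 0)"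
proof (cases "x\<^sup>2 < l")
  case True
  then have l: "0 < l" by (meson le_less_trans zero_le_power2)
  have "Psi_even (\<bar>x\<bar> / sqrt l) \<le> 1 + Psi 1 * (\<bar>x\<bar> / sqrt l)"
    by (rule Psi_even_le_linear[of 0 _ _ 1]) (use True l in \<open>auto simp: Psi_eq_Psi_even square_less_iff_abs_less_sqrt\<close>)
  from mult_left_mono[OF this, of "sqrt l"] l
  have "sqrt l * Psi_even (\<bar>x\<bar> / sqrt l) \<le> sqrt l + Psi 1 * \<bar>x\<bar>" by (simp add: algebra_simps)
  then show ?thesis using True l Psi_even_abs[of "x / sqrt l"] by (simp add: barrier_def)
qed (auto simp: barrier_def)

lemma barrier_scale:
  assumes "0 < c"
  shows "barrier (c * x) (c\<^sup>2 * l) = c * barrier x l"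
proof -
  have "(c * x)\<^sup>2 < c\<^sup>2 * l \<longleftrightarrow> x\<^sup>2 < l" using assms by (simp add: power_mult_distrib)
  then show ?thesis using assms by (simp add: barrier_def real_sqrt_mult abs_mult)
qed

text \<open>The bound \<open>ge\<close>, from
  \<open>\<bar>x + d\<bar> + \<bar>x - d\<bar> = 2 * max x d\<close>, settles
  \<open>x \<ge> 1\<close>, \<open>d \<ge> 1\<close> and, with \<open>outer_step\<close>, two ends
  outside. Otherwise \<open>heat_step_lower\<close> or \<open>mixed_step\<close> applies.\<close>

lemma barrier_step_unit:
  assumes "0 \<le> x" "0 \<le> d"
  shows "2 * barrier x 1 \<le> barrier (x + d) (1 - d\<^sup>2) + barrier (x - d) (1 - d\<^sup>2)"
proof -
  have k: "0 < Psi 1" using Psi_1_bounds by simp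
  have ge: "2 * (Psi 1 * max x d) \<le> barrier (x + d) (1 - d\<^sup>2) + barrier (x - d) (1 - d\<^sup>2)"
  proof -
    have "Psi 1 * (2 * max x d) = Psi 1 * (\<bar>x + d\<bar> + \<bar>x - d\<bar>)" using assms by auto
    also have "\<dots> \<le> barrier (x + d) (1 - d\<^sup>2) + barrier (x - d) (1 - d\<^sup>2)"
      unfolding distrib_left by (intro add_mono barrier_ge)
    finally show ?thesis by simp
  qed
  show ?thesis
  proof (cases "x < 1")
    case False
    then have "\<not> x\<^sup>2 < 1" using assms by (simp add: square_less_iff_abs_less_sqrt)
    then have "barrier x 1 = Psi 1 * x" using assms by (simp add: barrier_def)
    also have "\<dots> \<le> Psi 1 * max x d" using k by simp
    finally show ?thesis using ge by simp
  next
    case x1: True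
    then have bx: "barrier x 1 = Psi_even x" using assms by (simp add: barrier_def abs_square_less_1)
    show ?thesis
    proof (cases "d < 1")
      case False
      have "Psi_even x \<le> Psi 1 * 1" using Psi_even_mono[of x 1] assms x1 by (simp add: Psi_eq_Psi_even)
      also have "\<dots> \<le> Psi 1 * max x d" using k False by simp
      finally show ?thesis using ge bx by simp
    next
      case d1: True
      define s where "s = sqrt (1 - d\<^sup>2)"
      have d2: "d\<^sup>2 < 1" using d1 assms by (simp add: abs_square_less_1)
      then have s: "0 < s" by (simp add: s_def)
      consider "x + d < s" | "s \<le> x + d" "x \<le> d - s" | "s \<le> x + d" "d - s < x" by linarith
      then show ?thesis
      proof cases
        case 1
        then have "barrier (x + d) (1 - d\<^sup>2) = s * Psi_even ((x + d) / s)"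
            "barrier (x - d) (1 - d\<^sup>2) = s * Psi_even ((x - d) / s)"
          using assms by (auto simp: barrier_def square_less_iff_abs_less_sqrt s_def)
        then show ?thesis using heat_step_lower[of d 1 x] 1 assms d2 bx
          by (simp add: s_def distrib_left)
      next
        case 2
        then have "Psi_even x \<le> Psi 1 * d" using outer_step[of d x] assms d1 by (simp add: s_def)
        also have "\<dots> \<le> Psi 1 * max x d" using k by simp
        finally show ?thesis using ge bx by simp
      next
        case 3
        \<comment> \<open>With \<open>x < 1\<close> this gives \<open>x - d < s\<close>, so the left
          end is inside.\<close>
        have "1 - d \<le> s"
          unfolding s_def by (rule real_le_rsqrt)
            (use d1 assms in \<open>auto simp: power2_eq_square algebra_simps mult_left_le\<close>)
        then have "barrier (x - d) (1 - d\<^sup>2) = s * Psi_even ((x - d) / s)"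
          using 3 x1 by (auto simp: barrier_def square_less_iff_abs_less_sqrt s_def)
        moreover have "2 * Psi_even x \<le> Psi 1 * (x + d) + s * Psi_even ((x - d) / s)"
          unfolding s_def by (rule mixed_step) (use 3 assms d1 x1 in \<open>auto simp: s_def\<close>)
        ultimately show ?thesis using barrier_ge[of "x + d" "1 - d\<^sup>2"] assms bx by simp
      qed
    qed
  qed
qed

text \<open>For \<open>l \<le> 0\<close> this is the convexity of \<open>\<bar>x\<bar>\<close>. For
  \<open>l > 0\<close>, parabolic scaling by \<open>sqrt l\<close> and symmetry in \<open>x\<close>
  and \<open>d\<close> reduce it to the unit case.\<close>

lemma barrier_step:
  "2 * barrier x l \<le> barrier (x + d) (l - d\<^sup>2) + barrier (x - d) (l - d\<^sup>2)"
proof (cases "0 < l")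
  case False
  then have "\<not> x\<^sup>2 < l" by (meson le_less_trans zero_le_power2)
  then have "2 * barrier x l = Psi 1 * (2 * \<bar>x\<bar>)" by (simp add: barrier_def)
  also have "\<dots> \<le> Psi 1 * (\<bar>x + d\<bar> + \<bar>x - d\<bar>)" using Psi_1_bounds by (intro mult_left_mono) auto
  also have "\<dots> \<le> barrier (x + d) (l - d\<^sup>2) + barrier (x - d) (l - d\<^sup>2)"
    unfolding distrib_left by (intro add_mono barrier_ge)
  finally show ?thesis .
next
  case True
  define c where "c = sqrt l"
  have c: "0 < c" "l = c\<^sup>2" using True by (auto simp: c_def)
  have *: "2 * barrier x l \<le> barrier (x + d) (l - d\<^sup>2) + barrier (x - d) (l - d\<^sup>2)"
    if "0 \<le> x" "0 \<le> d" for x d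
  proof -
    have sc: "barrier (c * y) (c\<^sup>2 - d\<^sup>2) = c * barrier y (1 - (d / c)\<^sup>2)" for y
      using barrier_scale[OF c(1), of y "1 - (d / c)\<^sup>2"] c by (simp add: algebra_simps power_divide)
    have "2 * barrier (x / c) 1 \<le> barrier (x / c + d / c) (1 - (d / c)\<^sup>2) + barrier (x / c - d / c) (1 - (d / c)\<^sup>2)"
      by (rule barrier_step_unit) (use that c in auto)
    from mult_left_mono[OF this, of c] c(1)
    have "2 * (c * barrier (x / c) 1) \<le> c * barrier (x / c + d / c) (1 - (d / c)\<^sup>2) + c * barrier (x / c - d / c) (1 - (d / c)\<^sup>2)"
      by (simp add: algebra_simps)
    then show ?thesis
      using barrier_scale[OF c(1), of "x / c" 1] c(1) unfolding sc[symmetric] c(2) by (simp add: distrib_left right_diff_distrib)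
  qed
  have **: "2 * barrier x l \<le> barrier (x + d) (l - d\<^sup>2) + barrier (x - d) (l - d\<^sup>2)" if "0 \<le> x" for x d
    using *[OF that, of "\<bar>d\<bar>"] by (cases "0 \<le> d") (auto simp: add.commute)
  show ?thesis
  proof (cases "0 \<le> x")
    case False
    have "- x + d = - (x - d)" "- x - d = - (x + d)" by simp_all
    then have "barrier (- x + d) q = barrier (x - d) q" "barrier (- x - d) q = barrier (x + d) q" for q
      by (simp_all only: barrier_minus)
    then show ?thesis using **[of "- x" d] False by simp
  qed (rule **)
qed

subsection \<open>Dyadic intervals and averages\<close>

lemma halves_Ico:
  assumes "0 < h"
  shows "left_half {a..<a + 2 * h} = {a..<a + h}" "right_half {a..<a + 2 * h} = {a + h..<a + 2 * h}"
proof -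
  have "Inf {a..<a + 2 * h} = a" "Sup {a..<a + 2 * h} = a + 2 * h"
    using assms by (simp_all add: cInf_atLeastLessThan cSup_atLeastLessThan)
  then show "left_half {a..<a + 2 * h} = {a..<a + h}" "right_half {a..<a + 2 * h} = {a + h..<a + 2 * h}"
    by (simp_all add: left_half_def right_half_def add_divide_distrib)
qed

lemma two_powi_half: "(2::real) powi (- n) = 2 * 2 powi (- (n + 1))"
proof -
  have "(2::real) powi (- n) = 2 powi (1 + (- (n + 1)))" by simp
  also have "\<dots> = 2 powi 1 * 2 powi (- (n + 1))" by (rule power_int_add) simp
  finally show ?thesis by simp
qed

lemma dyadic_cases:
  assumes "J \<in> dyadic"
  obtains k n where "J = {of_int k * 2 powi (- n)..<(of_int k + 1) * 2 powi (- n)}"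
    and "left_half J = {of_int (2 * k) * 2 powi (- (n + 1))..<of_int (2 * k + 1) * 2 powi (- (n + 1))}"
    and "right_half J = {of_int (2 * k + 1) * 2 powi (- (n + 1))..<(of_int (2 * k + 1) + 1) * 2 powi (- (n + 1))}"
proof -
  obtain k n where J: "J = {of_int k * 2 powi (- n)..<(of_int k + 1) * 2 powi (- n)}"
    using assms by (auto simp: dyadic_def)
  define h :: real where "h = 2 powi (- (n + 1))"
  have h: "0 < h" "2 powi (- n) = 2 * h" by (simp_all add: h_def two_powi_half)
  have J': "J = {of_int (2 * k) * h..<of_int (2 * k) * h + 2 * h}" unfolding J h(2) by (simp add: algebra_simps)
  show ?thesis
  proof (rule that[OF J], unfold h_def[symmetric])
    show "left_half J = {of_int (2 * k) * h..<of_int (2 * k + 1) * h}"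
      unfolding J' halves_Ico[OF h(1)] by (simp add: distrib_right)
    show "right_half J = {of_int (2 * k + 1) * h..<(of_int (2 * k + 1) + 1) * h}"
      unfolding J' halves_Ico[OF h(1)] by (simp add: algebra_simps)
  qed
qed

lemma dyadic_halves: assumes "J \<in> dyadic" shows "left_half J \<in> dyadic" "right_half J \<in> dyadic"
proof -
  obtain k n where H: "left_half J = {of_int (2 * k) * 2 powi (- (n + 1))..<of_int (2 * k + 1) * 2 powi (- (n + 1))}"
    "right_half J = {of_int (2 * k + 1) * 2 powi (- (n + 1))..<(of_int (2 * k + 1) + 1) * 2 powi (- (n + 1))}"
    using dyadic_cases[OF assms] by metis
  then show "right_half J \<in> dyadic" unfolding dyadic_def by blast
  have "left_half J = {of_int (2 * k) * 2 powi (- (n + 1))..<(of_int (2 * k) + 1) * 2 powi (- (n + 1))}"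
    using H by simp
  then show "left_half J \<in> dyadic" unfolding dyadic_def by blast
qed

lemma dyadic_Ico:
  assumes "J \<in> dyadic"
  obtains a h where "0 < h" "J = {a..<a + 2 * h}" "left_half J = {a..<a + h}" "right_half J = {a + h..<a + 2 * h}"
proof -
  obtain k n where J: "J = {of_int k * 2 powi (- n)..<(of_int k + 1) * 2 powi (- n)}"
    using assms by (auto simp: dyadic_def)
  define h :: real where "h = 2 powi (- (n + 1))"
  have h: "0 < h" "2 powi (- n) = 2 * h" by (simp_all add: h_def two_powi_half)
  have "J = {of_int k * 2 powi (- n)..<of_int k * 2 powi (- n) + 2 * h}" unfolding J h(2) by (simp add: algebra_simps)
  with that[OF h(1) this] halves_Ico[OF h(1)] show ?thesis by simp
qed

lemma halves_partition:
  assumes "J \<in> dyadic"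
  shows "left_half J \<union> right_half J = J" "left_half J \<inter> right_half J = {}"
    "left_half J \<subseteq> J" "right_half J \<subseteq> J" "left_half J \<noteq> J" "right_half J \<noteq> J"
proof -
  obtain a h where *: "0 < h" "J = {a..<a + 2 * h}" "left_half J = {a..<a + h}" "right_half J = {a + h..<a + 2 * h}"
    using dyadic_Ico[OF assms] .
  show "left_half J \<union> right_half J = J" "left_half J \<inter> right_half J = {}"
    "left_half J \<subseteq> J" "right_half J \<subseteq> J"
    unfolding *(3,4) using * by auto
  have "a \<in> J" "a \<notin> right_half J" "a + h \<in> J" "a + h \<notin> left_half J"
    unfolding *(3,4) using * by auto
  then show "left_half J \<noteq> J" "right_half J \<noteq> J" by auto
qed

text \<open>If \<open>I\<close> is shorter than \<open>J\<close>, the midpoint of \<open>J\<close>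
  is an integer multiple \<open>M\<close> of the length of \<open>I\<close>, so \<open>I\<close>
  cannot straddle it.\<close>

lemma dyadic_nested:
  assumes "I \<in> dyadic" "J \<in> dyadic" "I \<subseteq> J"
  shows "I = J \<or> I \<subseteq> left_half J \<or> I \<subseteq> right_half J"
proof -
  obtain i n where I: "I = {of_int i * 2 powi (- n)..<(of_int i + 1) * 2 powi (- n)}"
    using assms(1) by (auto simp: dyadic_def)
  obtain j m where J: "J = {of_int j * 2 powi (- m)..<(of_int j + 1) * 2 powi (- m)}"
    "left_half J = {of_int (2 * j) * 2 powi (- (m + 1))..<of_int (2 * j + 1) * 2 powi (- (m + 1))}"
    "right_half J = {of_int (2 * j + 1) * 2 powi (- (m + 1))..<(of_int (2 * j + 1) + 1) * 2 powi (- (m + 1))}"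
    using dyadic_cases[OF assms(2)] by metis
  define q :: real where "q = 2 powi (- n)"
  define Q :: real where "Q = 2 powi (- m)"
  have q: "0 < q" and Q: "0 < Q" by (simp_all add: q_def Q_def)
  have sub: "of_int j * Q \<le> of_int i * q" "(of_int i + 1) * q \<le> (of_int j + 1) * Q"
    using assms(3) q unfolding I J(1) q_def[symmetric] Q_def[symmetric] by (auto simp: atLeastLessThan_subset_iff)
  then have "q \<le> Q" by (simp add: algebra_simps)
  then have "m \<le> n"
    using power_int_strict_increasing[of "- m" "- n" "2::real"] by (force simp: q_def Q_def)
  show ?thesis
  proof (cases "m = n")
    case True
    then have "Q = q" by (simp add: q_def Q_def)
    with sub q have "j = i" by simp
    with True I J show ?thesis by simp
  next
    case False
    define p where "p = nat (n - m - 1)"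
    define M where "M = (2 * j + 1) * 2 ^ p"
    have e: "- (m + 1) = int p + (- n)" using False \<open>m \<le> n\<close> by (simp add: p_def)
    have half: "2 powi (- (m + 1)) = 2 ^ p * q"
      unfolding e q_def by (subst power_int_add) simp_all
    have mid: "of_int (2 * j + 1) * 2 powi (- (m + 1)) = of_int M * q"
      unfolding half M_def by simp
    have lo: "of_int (2 * j) * 2 powi (- (m + 1)) = of_int j * Q"
      and hi: "(of_int (2 * j + 1) + 1) * 2 powi (- (m + 1)) = (of_int j + 1) * Q"
      unfolding Q_def by (simp_all add: two_powi_half[of m] algebra_simps)
    have "real_of_int (i + 1) \<le> of_int M \<or> real_of_int M \<le> of_int i"
      unfolding of_int_le_iff by linarith
    then have "(of_int i + 1) * q \<le> of_int M * q \<or> of_int M * q \<le> of_int i * q"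
      using q mult_right_mono[of _ _ q] by fastforce
    then show ?thesis
      unfolding J(2,3) I q_def[symmetric] mid lo hi using sub by auto
  qed
qed

section \<open>Measures and averages on dyadic intervals\<close>

lemma dyadic_sets [measurable]: "J \<in> dyadic \<Longrightarrow> J \<in> sets lebesgue"
  and dyadic_lmeasurable: "J \<in> dyadic \<Longrightarrow> J \<in> lmeasurable"
  by (auto simp: dyadic_def fmeasurable_def)

lemma measure_dyadic_pos: assumes "J \<in> dyadic" shows "0 < measure lebesgue J"
  using assms by (rule dyadic_Ico) simp

lemma measure_halves:
  assumes "J \<in> dyadic"
  shows "measure lebesgue (left_half J) = measure lebesgue J / 2"
    "measure lebesgue (right_half J) = measure lebesgue J / 2"
  using assms by (rule dyadic_Ico; simp)+

lemma set_integrable_halves: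
  fixes \<phi> :: "real \<Rightarrow> real"
  assumes "J \<in> dyadic" "set_integrable lebesgue J \<phi>"
  shows "set_integrable lebesgue (left_half J) \<phi>" "set_integrable lebesgue (right_half J) \<phi>"
  by (rule set_integrable_subset[OF assms(2)]; use assms(1) in \<open>simp add: dyadic_sets dyadic_halves halves_partition\<close>)+

lemma set_integral_halves:
  fixes \<phi> :: "real \<Rightarrow> real"
  assumes "J \<in> dyadic" "set_integrable lebesgue J \<phi>"
  shows "(LINT x:J|lebesgue. \<phi> x) = (LINT x:left_half J|lebesgue. \<phi> x) + (LINT x:right_half J|lebesgue. \<phi> x)"
  using set_integral_Un[OF halves_partition(2)[OF assms(1)] set_integrable_halves[OF assms]]
    halves_partition(1)[OF assms(1)] by simp

lemma avg_halves:
  assumes "J \<in> dyadic" "set_integrable lebesgue J \<phi>"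
  shows "avg J \<phi> = (avg (left_half J) \<phi> + avg (right_half J) \<phi>) / 2"
  unfolding avg_def set_integral_halves[OF assms] measure_halves[OF assms(1)]
  by (simp add: algebra_simps add_divide_distrib)

lemma avg_cong:
  assumes "I \<in> dyadic" "\<And>x. x \<in> I \<Longrightarrow> \<phi> x = \<psi> x"
  shows "avg I \<phi> = avg I \<psi>"
  unfolding avg_def using assms dyadic_sets by (simp add: set_lebesgue_integral_cong)

lemma abs_avg_le:
  assumes "J \<in> dyadic" "set_integrable lebesgue J \<phi>"
  shows "measure lebesgue J * \<bar>avg J \<phi>\<bar> \<le> (LINT x:J|lebesgue. \<bar>\<phi> x\<bar>)"
  using set_integral_norm_bound[OF assms(2)] measure_dyadic_pos[OF assms(1)]
  by (simp add: avg_def abs_mult)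

section \<open>The square function and its truncations\<close>

lemma Delta_square:
  assumes "J \<in> dyadic" "x \<in> J"
  shows "\<bar>Delta J \<phi> x\<bar>\<^sup>2 = ((avg (right_half J) \<phi> - avg (left_half J) \<phi>) / 2)\<^sup>2"
proof -
  have "x \<in> left_half J \<and> x \<notin> right_half J \<or> x \<in> right_half J \<and> x \<notin> left_half J"
    using halves_partition[OF assms(1)] assms(2) by blast
  then show ?thesis by (auto simp: Delta_def power2_eq_square)
qed

lemma Delta_cong:
  assumes "I \<in> dyadic" "\<And>x. x \<in> I \<Longrightarrow> \<phi> x = \<psi> x"
  shows "Delta I \<phi> = Delta I \<psi>"
proof -
  have "avg (left_half I) \<phi> = avg (left_half I) \<psi>" "avg (right_half I) \<phi> = avg (right_half I) \<psi>"
    using assms halves_partition[OF assms(1)] by (blast intro: avg_cong dyadic_halves)+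
  then show ?thesis by (simp add: Delta_def fun_eq_iff)
qed

lemma sqfun2_cong:
  assumes "\<And>x. x \<in> J \<Longrightarrow> \<phi> x = \<psi> x"
  shows "sqfun2 J \<phi> = sqfun2 J \<psi>"
proof -
  have "Delta I \<phi> = Delta I \<psi>" if "I \<in> dyadic" "I \<subseteq> J" for I
    using that assms by (intro Delta_cong) auto
  then show ?thesis unfolding sqfun2_def by (intro ext infsum_cong) auto
qed

text \<open>The series for \<open>J\<close> contains the term of \<open>J\<close> itself and,
  separately because \<open>H\<close> is a proper subset, all terms of \<open>H\<close>; the others
  are nonnegative.\<close>

lemma sqfun2_ge_half:
  assumes J: "J \<in> dyadic" and H: "H = left_half J \<or> H = right_half J" and x: "x \<in> J"
  shows "ennreal (((avg (right_half J) \<phi> - avg (left_half J) \<phi>) / 2)\<^sup>2) + sqfun2 H \<phi> x \<le> sqfun2 J \<phi> x"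
proof -
  define f where "f I = ennreal (\<bar>Delta I \<phi> x\<bar>\<^sup>2 * indicator I x)" for I
  have sm: "f summable_on A" for A by (rule nonneg_summable_on_complete) simp
  have HJ: "H \<subseteq> J" "H \<noteq> J" using H halves_partition[OF J] by auto
  then have "J \<notin> {I \<in> dyadic. I \<subseteq> H}" by auto
  then have "f J + infsum f {I \<in> dyadic. I \<subseteq> H} = infsum f (insert J {I \<in> dyadic. I \<subseteq> H})"
    using infsum_insert[OF sm] by metis
  also have "\<dots> \<le> infsum f {I \<in> dyadic. I \<subseteq> J}"
    by (rule infsum_mono_neutral[OF sm sm]) (use HJ J in auto)
  finally have "f J + sqfun2 H \<phi> x \<le> sqfun2 J \<phi> x" by (simp only: sqfun2_def f_def [abs_def])
  moreover have "f J = ennreal (((avg (right_half J) \<phi> - avg (left_half J) \<phi>) / 2)\<^sup>2)"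
    unfolding f_def Delta_square[OF J x] using x by simp
  ultimately show ?thesis by simp
qed

text \<open>The square function truncated to \<open>n\<close> generations; meaningful only at points of \<open>J\<close>.\<close>

primrec sq_part :: "nat \<Rightarrow> real set \<Rightarrow> (real \<Rightarrow> real) \<Rightarrow> real \<Rightarrow> real" where
  "sq_part 0 J \<phi> x = 0"
| "sq_part (Suc n) J \<phi> x = ((avg (right_half J) \<phi> - avg (left_half J) \<phi>) / 2)\<^sup>2
    + (if x \<in> left_half J then sq_part n (left_half J) \<phi> x else sq_part n (right_half J) \<phi> x)"

lemma sq_part_Suc_ge: "sq_part n J \<phi> x \<le> sq_part (Suc n) J \<phi> x"
  by (induction n arbitrary: J) (auto split: if_splits)

text \<open>The strict size condition restricts \<open>F\<close> to the first \<open>n\<close>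
  generations, counting \<open>J\<close> as the first; for \<open>n = 0\<close> it forces
  \<open>F\<close> to be empty. By nesting, the intervals other than \<open>J\<close> that contain
  \<open>x\<close> lie in the same half.\<close>

lemma finite_sum_le_sq_part:
  assumes "J \<in> dyadic" "finite F" "F \<subseteq> {I \<in> dyadic. I \<subseteq> J}"
    and "\<And>I. I \<in> F \<Longrightarrow> measure lebesgue J < 2 ^ n * measure lebesgue I" and "x \<in> J"
  shows "(\<Sum>I\<in>F. \<bar>Delta I \<phi> x\<bar>\<^sup>2 * indicator I x) \<le> sq_part n J \<phi> x"
  using assms
proof (induction n arbitrary: J F)
  case 0
  have "F = {}"
  proof (rule ccontr)
    assume "F \<noteq> {}"
    then obtain I where "I \<in> F" by auto
    then have "measure lebesgue I \<le> measure lebesgue J"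
      using 0 by (intro measure_mono_fmeasurable dyadic_sets dyadic_lmeasurable) auto
    with 0(4)[OF \<open>I \<in> F\<close>] show False by simp
  qed
  then show ?case by simp
next
  case (Suc n)
  define H where "H = (if x \<in> left_half J then left_half J else right_half J)"
  have xH: "x \<in> H" using halves_partition(1)[OF Suc.prems(1)] \<open>x \<in> J\<close> by (auto simp: H_def)
  have H: "H \<in> dyadic" "measure lebesgue H = measure lebesgue J / 2"
    using dyadic_halves measure_halves Suc.prems(1) by (auto simp: H_def)
  define G where "G = {I \<in> F. x \<in> I \<and> I \<noteq> J}"
  let ?f = "\<lambda>I. \<bar>Delta I \<phi> x\<bar>\<^sup>2 * indicator I x :: real"
  have G: "I \<subseteq> H" if "I \<in> G" for I
    using dyadic_nested[of I J] that Suc.prems(1,3) halves_partition(2)[OF Suc.prems(1)] xH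
    by (auto simp: G_def H_def split: if_splits)
  have "sum ?f F = sum ?f {I \<in> F. x \<in> I}"
    using Suc.prems(2) by (intro sum.mono_neutral_right) auto
  also have "\<dots> \<le> sum ?f (insert J G)"
    using Suc.prems(2) by (intro sum_mono2) (auto simp: G_def)
  also have "\<dots> = ?f J + sum ?f G"
    by (rule sum.insert) (use Suc.prems(2) in \<open>auto simp: G_def\<close>)
  also have "sum ?f G \<le> sq_part n H \<phi> x"
  proof (rule Suc.IH[OF H(1) _ _ _ xH])
    show "measure lebesgue H < 2 ^ n * measure lebesgue I" if "I \<in> G" for I
      using Suc.prems(4)[of I] that H(2) by (simp add: G_def)
  qed (use G Suc.prems in \<open>auto simp: G_def\<close>)
  finally show ?case
    using Delta_square[OF Suc.prems(1) \<open>x \<in> J\<close>] \<open>x \<in> J\<close> by (auto simp: H_def)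
qed

text \<open>The series is the supremum of its finite partial sums, so strictness yields a finite sum
  above \<open>l\<close>, and finitely many intervals span finitely many generations.\<close>

lemma sq_part_exceeds:
  assumes J: "J \<in> dyadic" "x \<in> J" and l: "ennreal l < sqfun2 J \<phi> x"
  shows "\<exists>n. l \<le> sq_part n J \<phi> x"
proof -
  have "sqfun2 J \<phi> x = (SUP F\<in>{F. finite F \<and> F \<subseteq> {I \<in> dyadic. I \<subseteq> J}}. \<Sum>I\<in>F. ennreal (\<bar>Delta I \<phi> x\<bar>\<^sup>2 * indicator I x))"
    unfolding sqfun2_def by (rule nonneg_infsum_complete) simp
  then obtain F where F: "finite F" "F \<subseteq> {I \<in> dyadic. I \<subseteq> J}"
    and lF: "ennreal l < (\<Sum>I\<in>F. ennreal (\<bar>Delta I \<phi> x\<bar>\<^sup>2 * indicator I x))"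
    using l by (auto simp: less_SUP_iff)
  have "\<forall>I\<in>F. \<forall>\<^sub>F n in sequentially. measure lebesgue J < 2 ^ n * measure lebesgue I"
  proof
    fix I assume "I \<in> F"
    then have "0 < measure lebesgue I" using F measure_dyadic_pos by auto
    moreover obtain N where "measure lebesgue J / measure lebesgue I < 2 ^ N"
      using real_arch_pow[of 2] by auto
    then have "\<forall>\<^sub>F n in sequentially. measure lebesgue J / measure lebesgue I < 2 ^ n"
      unfolding eventually_sequentially
      by (meson less_le_trans one_le_numeral power_increasing)
    ultimately show "\<forall>\<^sub>F n in sequentially. measure lebesgue J < 2 ^ n * measure lebesgue I"
      by (simp add: field_simps)
  qed
  then have "\<forall>\<^sub>F n in sequentially. \<forall>I\<in>F. measure lebesgue J < 2 ^ n * measure lebesgue I"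
    using F(1) by (rule eventually_ball_finite[rotated])
  then obtain n where n: "\<And>I. I \<in> F \<Longrightarrow> measure lebesgue J < 2 ^ n * measure lebesgue I"
    unfolding eventually_sequentially by blast
  have "ennreal l < ennreal (\<Sum>I\<in>F. \<bar>Delta I \<phi> x\<bar>\<^sup>2 * indicator I x)"
    using lF by (subst (asm) sum_ennreal) auto
  then have "l < (\<Sum>I\<in>F. \<bar>Delta I \<phi> x\<bar>\<^sup>2 * indicator I x)"
    by (meson ennreal_leI leD not_le_imp_less)
  also have "\<dots> \<le> sq_part n J \<phi> x"
    by (rule finite_sum_le_sq_part[OF J(1) F n J(2)])
  finally show ?thesis by (blast intro: less_imp_le)
qed

subsection \<open>The weak-type inequality\<close>

text \<open>Each generation is one \<open>barrier_step\<close>. The missing amount \<open>l\<close>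
  drops along the recursion and may become negative, while the fixed \<open>L\<close> bounds it
  throughout and gives a common factor \<open>sqrt L\<close>. Measurability is carried along for the
  additivity of the measure.\<close>

lemma sq_part_barrier:
  assumes "J \<in> dyadic" "set_integrable lebesgue J \<phi>" "l \<le> L" "0 \<le> L"
  shows "{x \<in> J. sq_part n J \<phi> x < l} \<in> sets lebesgue \<and>
    measure lebesgue J * barrier (avg J \<phi>) l \<le> Psi 1 * (LINT x:J|lebesgue. \<bar>\<phi> x\<bar>)
      + sqrt L * measure lebesgue {x \<in> J. sq_part n J \<phi> x < l}"
  using assms(1-3)
proof (induction n arbitrary: J l)
  case 0
  have m: "0 < measure lebesgue J" by (rule measure_dyadic_pos[OF 0(1)])
  have "measure lebesgue J * barrier (avg J \<phi>) l
      \<le> measure lebesgue J * (Psi 1 * \<bar>avg J \<phi>\<bar> + (if 0 < l then sqrt l else 0))"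
    using m barrier_le by (intro mult_left_mono) auto
  also have "\<dots> = Psi 1 * (measure lebesgue J * \<bar>avg J \<phi>\<bar>) + (if 0 < l then sqrt l else 0) * measure lebesgue J"
    by (simp add: algebra_simps)
  also have "\<dots> \<le> Psi 1 * (LINT x:J|lebesgue. \<bar>\<phi> x\<bar>) + (if 0 < l then sqrt L else 0) * measure lebesgue J"
    using 0 m Psi_1_bounds by (intro add_mono mult_left_mono mult_right_mono abs_avg_le) auto
  \<comment> \<open>As \<open>sq_part 0\<close> vanishes, the set in question is \<open>J\<close>
    for \<open>0 < l\<close> and empty otherwise.\<close>
  finally show ?case using dyadic_sets[OF 0(1)] by (cases "0 < l") simp_all
next
  case (Suc n)
  let ?L = "left_half J" and ?R = "right_half J"
  define d where "d = (avg ?R \<phi> - avg ?L \<phi>) / 2"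
  define A where "A = {x \<in> ?L. sq_part n ?L \<phi> x < l - d\<^sup>2}"
  define B where "B = {x \<in> ?R. sq_part n ?R \<phi> x < l - d\<^sup>2}"
  note H = dyadic_halves[OF Suc.prems(1)] set_integrable_halves[OF Suc.prems(1,2)]
  have l: "l - d\<^sup>2 \<le> L" using Suc.prems(3) by (smt (verit) zero_le_power2)
  have IH: "A \<in> sets lebesgue" "B \<in> sets lebesgue"
    "measure lebesgue ?L * barrier (avg ?L \<phi>) (l - d\<^sup>2) \<le> Psi 1 * (LINT x:?L|lebesgue. \<bar>\<phi> x\<bar>) + sqrt L * measure lebesgue A"
    "measure lebesgue ?R * barrier (avg ?R \<phi>) (l - d\<^sup>2) \<le> Psi 1 * (LINT x:?R|lebesgue. \<bar>\<phi> x\<bar>) + sqrt L * measure lebesgue B"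
    using Suc.IH[OF H(1,3) l] Suc.IH[OF H(2,4) l] by (simp_all add: A_def B_def)
  have "A \<in> lmeasurable" "B \<in> lmeasurable"
    using IH(1,2) dyadic_lmeasurable[OF H(1)] dyadic_lmeasurable[OF H(2)]
    by (auto intro: fmeasurableI2 simp: A_def B_def)
  moreover have "A \<inter> B = {}"
    using halves_partition(2)[OF Suc.prems(1)] by (auto simp: A_def B_def)
  ultimately have mAB: "measure lebesgue (A \<union> B) = measure lebesgue A + measure lebesgue B"
    using IH(1,2) by (intro measure_Union) (auto simp: fmeasurable_def)
  have S: "{x \<in> J. sq_part (Suc n) J \<phi> x < l} = A \<union> B"
    using halves_partition(1,2)[OF Suc.prems(1)] by (auto simp: A_def B_def d_def)
  have "avg J \<phi> + d = avg ?R \<phi>" "avg J \<phi> - d = avg ?L \<phi>"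
    unfolding avg_halves[OF Suc.prems(1,2)] d_def by (simp_all add: field_simps)
  then have "2 * barrier (avg J \<phi>) l \<le> barrier (avg ?R \<phi>) (l - d\<^sup>2) + barrier (avg ?L \<phi>) (l - d\<^sup>2)"
    using barrier_step[of "avg J \<phi>" l d] by simp
  from mult_left_mono[OF this, of "measure lebesgue J / 2"]
  have "measure lebesgue J * barrier (avg J \<phi>) l \<le>
      measure lebesgue ?R * barrier (avg ?R \<phi>) (l - d\<^sup>2) + measure lebesgue ?L * barrier (avg ?L \<phi>) (l - d\<^sup>2)"
    unfolding measure_halves[OF Suc.prems(1)] by (simp add: algebra_simps)
  also have "\<dots> \<le> Psi 1 * (LINT x:J|lebesgue. \<bar>\<phi> x\<bar>) + sqrt L * measure lebesgue (A \<union> B)"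
    using IH(3,4) unfolding mAB set_integral_halves[OF Suc.prems(1) set_integrable_abs[OF Suc.prems(2)]]
    by (simp add: distrib_left)
  finally show ?case unfolding S using IH(1,2) by auto
qed

text \<open>The lower threshold \<open>l\<close> is reached by some truncation at every point of the
  level set for \<open>lam\<close>, so that set lies in the increasing union of the
  \<open>E n\<close>, whose measures are bounded uniformly.\<close>

lemma weak_type_below:
  assumes J: "J \<in> dyadic" and int: "set_integrable lebesgue J \<phi>" and l: "0 < l" "l < lam"
  shows "sqrt l * measure lebesgue {x \<in> J. sqfun2 J \<phi> x \<ge> ennreal lam} \<le> Psi 1 * (LINT x:J|lebesgue. \<bar>\<phi> x\<bar>)"
proof -
  define E where "E n = {x \<in> J. l \<le> sq_part n J \<phi> x}" for n
  define A where "A = {x \<in> J. sqfun2 J \<phi> x \<ge> ennreal lam}"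
  have E: "E n = J - {x \<in> J. sq_part n J \<phi> x < l}" for n by (auto simp: E_def)
  have Es: "E n \<in> sets lebesgue" for n
    unfolding E using sq_part_barrier[OF J int order_refl, of l] l dyadic_sets[OF J] by auto
  have mE: "measure lebesgue (E n) \<le> Psi 1 * (LINT x:J|lebesgue. \<bar>\<phi> x\<bar>) / sqrt l" for n
  proof -
    have "sqrt l * measure lebesgue J \<le> measure lebesgue J * barrier (avg J \<phi>) l"
      using mult_left_mono[OF barrier_ge_sqrt[of l "avg J \<phi>"], of "measure lebesgue J"] l by (simp add: mult.commute)
    also have "\<dots> \<le> Psi 1 * (LINT x:J|lebesgue. \<bar>\<phi> x\<bar>) + sqrt l * measure lebesgue {x \<in> J. sq_part n J \<phi> x < l}"
      using sq_part_barrier[OF J int order_refl, of l n] l by auto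
    finally have "sqrt l * (measure lebesgue J - measure lebesgue {x \<in> J. sq_part n J \<phi> x < l})
      \<le> Psi 1 * (LINT x:J|lebesgue. \<bar>\<phi> x\<bar>)" by (simp add: algebra_simps)
    moreover have "measure lebesgue (E n) = measure lebesgue J - measure lebesgue {x \<in> J. sq_part n J \<phi> x < l}"
      unfolding E using sq_part_barrier[OF J int order_refl, of l n] l
      by (intro measurable_measure_Diff dyadic_lmeasurable J) auto
    ultimately have "sqrt l * measure lebesgue (E n) \<le> Psi 1 * (LINT x:J|lebesgue. \<bar>\<phi> x\<bar>)" by simp
    then show ?thesis using l by (simp add: field_simps)
  qed
  have UE: "(\<Union>n. E n) \<in> lmeasurable"
    by (rule fmeasurableI2[OF dyadic_lmeasurable[OF J]]) (use Es in \<open>auto simp: E_def\<close>)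
  have "incseq E"
    unfolding E_def by (rule incseq_SucI) (use sq_part_Suc_ge order_trans in blast)
  then have "(\<lambda>n. measure lebesgue (E n)) \<longlonglongrightarrow> measure lebesgue (\<Union>n. E n)"
    using Es UE by (intro Lim_measure_incseq) (auto simp: fmeasurable_def)
  then have UE': "measure lebesgue (\<Union>n. E n) \<le> Psi 1 * (LINT x:J|lebesgue. \<bar>\<phi> x\<bar>) / sqrt l"
    using mE by (intro LIMSEQ_le_const2) auto
  have sub: "A \<subseteq> (\<Union>n. E n)"
  proof
    fix x assume "x \<in> A"
    moreover have "ennreal l < ennreal lam" using l by (simp add: ennreal_lessI)
    ultimately have x: "x \<in> J" "ennreal l < sqfun2 J \<phi> x"
      using less_le_trans unfolding A_def by blast+
    then show "x \<in> (\<Union>n. E n)" using sq_part_exceeds[OF J x(1,2)] by (auto simp: E_def)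
  qed
  \<comment> \<open>For a nonmeasurable \<open>A\<close>, \<open>measure\<close> would take the
    default value 0.\<close>
  have "measure lebesgue A \<le> measure lebesgue (\<Union>n. E n)"
    by (cases "A \<in> sets lebesgue") (use sub UE in \<open>auto simp: measure_notin_sets intro: measure_mono_fmeasurable\<close>)
  with UE' have "measure lebesgue A \<le> Psi 1 * (LINT x:J|lebesgue. \<bar>\<phi> x\<bar>) / sqrt l" by linarith
  then show ?thesis using l by (simp add: A_def field_simps)
qed

lemma weak_type_Psi_1: "weak_type_ineq (Psi 1)"
  unfolding weak_type_ineq_def
proof (intro ballI allI impI)
  fix J and \<phi> :: "real \<Rightarrow> real" and lam :: real
  assume J: "J \<in> dyadic" and lam: "0 < lam" and int: "set_integrable lebesgue J \<phi>"
  define M where "M = measure lebesgue {x \<in> J. sqfun2 J \<phi> x \<ge> ennreal lam}"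
  have "sqrt lam * M \<le> Psi 1 * (LINT x:J|lebesgue. \<bar>\<phi> x\<bar>)"
  \<comment> \<open>The factor \<open>t\<close> corresponds to the lower threshold
    \<open>t\<^sup>2 * lam\<close>, with \<open>t\<close> tending to 1.\<close>
  proof (rule field_le_mult_one_interval)
    fix t :: real assume t: "0 < t" "t < 1"
    then have "t\<^sup>2 < 1" by (simp add: abs_square_less_1)
    then have "sqrt (t\<^sup>2 * lam) * M \<le> Psi 1 * (LINT x:J|lebesgue. \<bar>\<phi> x\<bar>)"
      unfolding M_def using t lam by (intro weak_type_below J int) auto
    then show "t * (sqrt lam * M) \<le> Psi 1 * (LINT x:J|lebesgue. \<bar>\<phi> x\<bar>)"
      using t by (simp add: real_sqrt_mult mult.assoc)
  qed
  then show "1 / measure lebesgue J * M \<le> Psi 1 * (1 / sqrt lam) * avg J (\<lambda>x. \<bar>\<phi> x\<bar>)"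
    using lam measure_dyadic_pos[OF J] by (simp add: avg_def field_simps)
qed

subsection \<open>Sharpness\<close>

text \<open>\<open>c\<close> is the attained cost in mean absolute value. Quantifying over all
  \<open>J\<close> allows such functions to be glued from the two halves of an interval.\<close>

definition sq_attains :: "real \<Rightarrow> real \<Rightarrow> real \<Rightarrow> bool" where
  "sq_attains l x c \<longleftrightarrow> (\<forall>J\<in>dyadic. \<exists>\<phi>. set_integrable lebesgue J \<phi> \<and> avg J \<phi> = x \<and>
    avg J (\<lambda>t. \<bar>\<phi> t\<bar>) = c \<and> (\<forall>t\<in>J. ennreal l \<le> sqfun2 J \<phi> t))"

lemma sq_attains_const: "sq_attains 0 x \<bar>x\<bar>"
  unfolding sq_attains_def
proof (intro ballI exI conjI)
  fix J assume J: "J \<in> dyadic"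
  have c: "avg J (\<lambda>_. c) = c" for c
    using set_integral_const[of J lebesgue c] dyadic_lmeasurable[OF J] measure_dyadic_pos[OF J]
    by (auto simp: avg_def fmeasurable_def)
  show "avg J (\<lambda>_. x) = x" "avg J (\<lambda>t. \<bar>x\<bar>) = \<bar>x\<bar>" by (rule c)+
  show "set_integrable lebesgue J (\<lambda>_. x)"
    using dyadic_lmeasurable[OF J]
    by (auto simp: set_integrable_def fmeasurable_def intro!: integrable_mult_left integrable_real_indicator)
qed simp

text \<open>Two functions are glued along the halves of \<open>J\<close>; the difference of their
  means contributes \<open>d\<^sup>2\<close> at every point.\<close>

lemma sq_attains_split:
  assumes L: "sq_attains l (x - d) c\<^sub>1" and R: "sq_attains l (x + d) c\<^sub>2" and l: "0 \<le> l"
  shows "sq_attains (l + d\<^sup>2) x ((c\<^sub>1 + c\<^sub>2) / 2)"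
  unfolding sq_attains_def
proof
  fix J assume J: "J \<in> dyadic"
  note H = dyadic_halves[OF J]
  obtain f where f: "set_integrable lebesgue (left_half J) f" "avg (left_half J) f = x - d"
    "avg (left_half J) (\<lambda>t. \<bar>f t\<bar>) = c\<^sub>1" "\<forall>t\<in>left_half J. ennreal l \<le> sqfun2 (left_half J) f t"
    using L H(1) unfolding sq_attains_def by meson
  obtain g where g: "set_integrable lebesgue (right_half J) g" "avg (right_half J) g = x + d"
    "avg (right_half J) (\<lambda>t. \<bar>g t\<bar>) = c\<^sub>2" "\<forall>t\<in>right_half J. ennreal l \<le> sqfun2 (right_half J) g t"
    using R H(2) unfolding sq_attains_def by meson
  define \<phi> where "\<phi> t = (if t \<in> left_half J then f t else g t)" for t
  have eqL: "\<phi> t = f t" if "t \<in> left_half J" for t using that by (simp add: \<phi>_def)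
  have eqR: "\<phi> t = g t" if "t \<in> right_half J" for t
    using that halves_partition(2)[OF J] by (auto simp: \<phi>_def)
  have "set_integrable lebesgue (left_half J) \<phi> \<longleftrightarrow> set_integrable lebesgue (left_half J) f"
    by (rule set_integrable_cong) (simp_all add: eqL)
  moreover have "set_integrable lebesgue (right_half J) \<phi> \<longleftrightarrow> set_integrable lebesgue (right_half J) g"
    by (rule set_integrable_cong) (simp_all add: eqR)
  ultimately have int: "set_integrable lebesgue J \<phi>"
    using set_integrable_Un[of lebesgue "left_half J" \<phi> "right_half J"] halves_partition(1)[OF J] H
    by (simp add: dyadic_sets f(1) g(1))
  have aL: "avg (left_half J) \<phi> = x - d" and aR: "avg (right_half J) \<phi> = x + d"
    using avg_cong[OF H(1) eqL] avg_cong[OF H(2) eqR] f(2) g(2) by auto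
  then have "avg J \<phi> = x" using avg_halves[OF J int] by simp
  moreover have "avg (left_half J) (\<lambda>t. \<bar>\<phi> t\<bar>) = c\<^sub>1" "avg (right_half J) (\<lambda>t. \<bar>\<phi> t\<bar>) = c\<^sub>2"
    using avg_cong[OF H(1), of "\<lambda>t. \<bar>\<phi> t\<bar>" "\<lambda>t. \<bar>f t\<bar>"] avg_cong[OF H(2), of "\<lambda>t. \<bar>\<phi> t\<bar>" "\<lambda>t. \<bar>g t\<bar>"]
      eqL eqR f(3) g(3) by auto
  then have "avg J (\<lambda>t. \<bar>\<phi> t\<bar>) = (c\<^sub>1 + c\<^sub>2) / 2"
    using avg_halves[OF J set_integrable_abs[OF int]] by simp
  moreover have "ennreal (l + d\<^sup>2) \<le> sqfun2 J \<phi> t" if t: "t \<in> J" for t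
  proof -
    have "\<exists>K. (K = left_half J \<or> K = right_half J) \<and> ennreal l \<le> sqfun2 K \<phi> t"
    proof (cases "t \<in> left_half J")
      case True
      moreover have "sqfun2 (left_half J) \<phi> = sqfun2 (left_half J) f" by (rule sqfun2_cong) (rule eqL)
      ultimately show ?thesis using f(4) by metis
    next
      case False
      then have "t \<in> right_half J" using t halves_partition(1)[OF J] by auto
      moreover have "sqfun2 (right_half J) \<phi> = sqfun2 (right_half J) g" by (rule sqfun2_cong) (rule eqR)
      ultimately show ?thesis using g(4) by metis
    qed
    then obtain K where K: "K = left_half J \<or> K = right_half J" "ennreal l \<le> sqfun2 K \<phi> t" by auto
    have "ennreal (l + d\<^sup>2) = ennreal (d\<^sup>2) + ennreal l" using l by (simp add: ennreal_plus add.commute)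
    also have "\<dots> \<le> ennreal (d\<^sup>2) + sqfun2 K \<phi> t" using K(2) by (rule add_left_mono)
    also have "\<dots> \<le> sqfun2 J \<phi> t"
      using sqfun2_ge_half[OF J K(1) t, of \<phi>] by (simp add: aL aR)
    finally show ?thesis .
  qed
  ultimately show "\<exists>\<phi>. set_integrable lebesgue J \<phi> \<and> avg J \<phi> = x \<and>
    avg J (\<lambda>t. \<bar>\<phi> t\<bar>) = (c\<^sub>1 + c\<^sub>2) / 2 \<and> (\<forall>t\<in>J. ennreal (l + d\<^sup>2) \<le> sqfun2 J \<phi> t)"
    using int by blast
qed

text \<open>The constants \<open>x - sqrt l\<close> and \<open>x + sqrt l\<close> on the two halves
  supply the whole of \<open>l\<close> in one generation. The cost stays
  \<open>\<bar>x\<bar>\<close> if \<open>\<bar>x\<bar> \<ge> sqrt l\<close>.\<close>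

lemma sq_attains_jump:
  assumes "0 \<le> l"
  shows "sq_attains l x (max \<bar>x\<bar> (sqrt l))"
proof -
  have "(\<bar>x - s\<bar> + \<bar>x + s\<bar>) / 2 = max \<bar>x\<bar> s" if "0 \<le> s" for s
    using that by (auto simp: abs_if max_def)
  from this[OF real_sqrt_ge_zero[OF assms]] show ?thesis
    using sq_attains_split[OF sq_attains_const[of "x - sqrt l"] sq_attains_const[of "x + sqrt l"] order_refl] assms by simp
qed

lemma weak_type_ineq_attains:
  assumes C: "weak_type_ineq C" and att: "sq_attains l x c" and l: "0 < l"
  shows "sqrt l \<le> C * c"
proof -
  define J :: "real set" where "J = {0..<1}"
  have "J = {of_int 0 * 2 powi (- 0)..<(of_int 0 + 1) * 2 powi (- 0)}" by (simp add: J_def)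
  then have J: "J \<in> dyadic" unfolding dyadic_def by blast
  have m: "measure lebesgue J = 1" by (simp add: J_def)
  obtain \<phi> where \<phi>: "set_integrable lebesgue J \<phi>" "avg J (\<lambda>t. \<bar>\<phi> t\<bar>) = c"
    "\<forall>t\<in>J. ennreal l \<le> sqfun2 J \<phi> t" using att J unfolding sq_attains_def by meson
  have "{t \<in> J. sqfun2 J \<phi> t \<ge> ennreal l} = J" using \<phi>(3) by auto
  moreover have "1 / measure lebesgue J * measure lebesgue {t \<in> J. sqfun2 J \<phi> t \<ge> ennreal l}
      \<le> C * (1 / sqrt l) * avg J (\<lambda>t. \<bar>\<phi> t\<bar>)"
    using C J l \<phi>(1) unfolding weak_type_ineq_def by blast
  ultimately have "1 \<le> C * (1 / sqrt l) * c" using m \<phi>(2) by simp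
  then show ?thesis using l by (simp add: field_simps)
qed

text \<open>The extremal process: a simple random walk with \<open>j\<close> counting the remaining steps, stopped
  when it leaves the parabola \<open>x\<^sup>2 < j\<close>, and completed there by one jump of size \<open>sqrt j\<close>.\<close>

lemma random_walk_attains:
  assumes "1 \<le> j" "\<bar>x\<bar> \<le> sqrt j + 2"
  shows "\<exists>c. sq_attains (real j) x c \<and> Psi 1 * c \<le> sqrt j * Psi_even (x / sqrt j)
    + 2 * Psi 1 + (\<Sum>i=1..<j. 1 / (3 * sqrt (real i) ^ 3))"
  using assms
proof (induction j arbitrary: x)
  case (Suc j)
  let ?s = "sqrt (Suc j)"
  have k: "1 \<le> Psi 1" using Psi_1_bounds by simp
  have s: "1 \<le> ?s" by simp
  have sum0: "0 \<le> (\<Sum>i=1..<n. 1 / (3 * sqrt (real i) ^ 3))" for n :: nat by (intro sum_nonneg) auto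
  consider "?s \<le> \<bar>x\<bar>" | "\<bar>x\<bar> < ?s" "j = 0" | "\<bar>x\<bar> < ?s" "1 \<le> j" by linarith
  then show ?case
  proof cases
    case 1
    \<comment> \<open>The walk stops here. The jump costs \<open>\<bar>x\<bar>\<close>, which
      exceeds \<open>?s\<close> by at most 2: this is the source of
      \<open>2 * Psi 1\<close>.\<close>
    have "Psi 1 * max \<bar>x\<bar> ?s \<le> Psi 1 * (?s + 2)" using Suc.prems 1 k by (intro mult_left_mono) auto
    also have "\<dots> = ?s * Psi 1 + 2 * Psi 1" by (simp add: algebra_simps)
    also have "?s * Psi 1 \<le> ?s * Psi_even (\<bar>x\<bar> / ?s)"
      using 1 s Psi_even_mono[of 1 "\<bar>x\<bar> / ?s"] by (intro mult_left_mono) (auto simp: Psi_eq_Psi_even)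
    also have "Psi_even (\<bar>x\<bar> / ?s) = Psi_even (x / ?s)" using Psi_even_abs[of "x / ?s"] by simp
    finally have "Psi 1 * max \<bar>x\<bar> ?s \<le> ?s * Psi_even (x / ?s) + 2 * Psi 1
        + (\<Sum>i=1..<Suc j. 1 / (3 * sqrt (real i) ^ 3))"
      using sum0[of "Suc j"] by linarith
    then show ?thesis
      by (intro exI[of _ "max \<bar>x\<bar> ?s"] conjI sq_attains_jump) simp_all
  next
    case 2
    \<comment> \<open>One unit is missing; the jump costs 1, covered by the term
      \<open>2 * Psi 1\<close>.\<close>
    then show ?thesis
      using Psi_even_ge_1[of x] k by (intro exI[of _ "max \<bar>x\<bar> ?s"] conjI sq_attains_jump) simp_all
  next
    case 3
    \<comment> \<open>A step moves \<open>x\<close> by 1 and lowers the square root by at most 1, so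
      from inside the parabola the overshoot is at most 2.\<close>
    have "?s \<le> sqrt j + 1" using sqrt_add_le_add_sqrt[of "real j" 1] by (simp add: add.commute)
    then have x: "\<bar>x - 1\<bar> \<le> sqrt j + 2" "\<bar>x + 1\<bar> \<le> sqrt j + 2" using 3 by auto
    define e where "e = 2 * Psi 1 + (\<Sum>i=1..<j. 1 / (3 * sqrt (real i) ^ 3))"
    obtain a where a: "sq_attains (real j) (x - 1) a" "Psi 1 * a \<le> sqrt j * Psi_even ((x - 1) / sqrt j) + e"
      using Suc.IH[OF 3(2) x(1)] by (auto simp: e_def add.assoc)
    obtain b where b: "sq_attains (real j) (x + 1) b" "Psi 1 * b \<le> sqrt j * Psi_even ((x + 1) / sqrt j) + e"
      using Suc.IH[OF 3(2) x(2)] by (auto simp: e_def add.assoc)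
    have att: "sq_attains (real (Suc j)) x ((a + b) / 2)"
      using sq_attains_split[OF a(1) b(1)] by (simp add: add.commute)
    have "sqrt j * (Psi_even ((x + 1) / sqrt j) + Psi_even ((x - 1) / sqrt j))
        \<le> 2 * (?s * Psi_even (x / ?s)) + 2 / (3 * sqrt j ^ 3)"
      using heat_step_upper[of 1 "real (Suc j)" x] 3 by simp
    then have "sqrt j * Psi_even ((x + 1) / sqrt j) + sqrt j * Psi_even ((x - 1) / sqrt j)
        \<le> 2 * (?s * Psi_even (x / ?s)) + 2 * (1 / (3 * sqrt j ^ 3))"
      by (simp add: distrib_left)
    moreover have "(u + v) / 2 \<le> z + (e + w)"
      if "p + q \<le> 2 * z + 2 * w" "u \<le> q + e" "v \<le> p + e" for p q u v w z
      using that by (simp add: field_simps)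
    ultimately have "(Psi 1 * a + Psi 1 * b) / 2 \<le> ?s * Psi_even (x / ?s) + (e + 1 / (3 * sqrt j ^ 3))"
      using a(2) b(2) by blast
    then have "Psi 1 * ((a + b) / 2) \<le> ?s * Psi_even (x / ?s) + (e + 1 / (3 * sqrt j ^ 3))"
      by (simp add: distrib_left)
    with att show ?thesis
      using 3 unfolding e_def by (intro exI[of _ "(a + b) / 2"] conjI) (simp_all add: add.assoc)
  qed
qed simp

text \<open>A convergent p-series with exponent \<open>3 / 2\<close>; the total error along the walk
  is thus bounded independently of its length.\<close>

lemma sum_inverse_sqrt_cube_bounded: "\<exists>K\<ge>0. \<forall>n::nat. (\<Sum>i=1..<n. 1 / (3 * sqrt (real i) ^ 3)) \<le> K"
proof -
  have "summable (\<lambda>i::nat. real i powr (- 3 / 2))" by (simp add: summable_real_powr_iff)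
  moreover have "1 / (3 * sqrt i ^ 3) = real i powr (- 3 / 2) / 3" for i :: nat
  proof (cases "i = 0")
    case False
    then have "sqrt i ^ 3 = real i powr (3 / 2)"
      by (simp add: powr_half_sqrt[symmetric] powr_power)
    then show ?thesis by (simp add: powr_minus field_simps)
  qed simp
  ultimately have sm: "summable (\<lambda>i::nat. 1 / (3 * sqrt i ^ 3))"
    by (simp only: summable_divide)
  have "(\<Sum>i=1..<n. 1 / (3 * sqrt (real i) ^ 3)) \<le> (\<Sum>i. 1 / (3 * sqrt (real i) ^ 3))" for n :: nat
    by (rule sum_le_suminf[OF sm]) auto
  moreover have "0 \<le> (\<Sum>i. 1 / (3 * sqrt (real i) ^ 3))" by (rule suminf_nonneg[OF sm]) auto
  ultimately show ?thesis by blast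
qed

text \<open>The walk from 0 with \<open>l = n\<close> gives
  \<open>Psi 1 * sqrt n \<le> C * (sqrt n + B)\<close> with \<open>B\<close> independent of
  \<open>n\<close>. Division by \<open>sqrt n\<close> and \<open>n\<close> tending to infinity leave
  \<open>Psi 1 \<le> C\<close>.\<close>

lemma Psi_1_optimal:
  assumes C: "weak_type_ineq C"
  shows "Psi 1 \<le> C"
proof -
  obtain K where K: "0 \<le> K" "\<And>n::nat. (\<Sum>i=1..<n. 1 / (3 * sqrt (real i) ^ 3)) \<le> K"
    using sum_inverse_sqrt_cube_bounded by auto
  define B where "B = 2 * Psi 1 + K"
  have k: "0 < Psi 1" using Psi_1_bounds by simp
  have "Psi 1 \<le> C * (1 + B / sqrt n)" if n: "1 \<le> n" for n :: nat
  proof -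
    obtain c where c: "sq_attains (real n) 0 c" "Psi 1 * c \<le> sqrt n + B"
      using random_walk_attains[OF n, of 0] K(2)[of n] unfolding B_def by fastforce
    have s: "0 < sqrt n" and sc: "sqrt n \<le> C * c"
      using n weak_type_ineq_attains[OF C c(1)] by auto
    \<comment> \<open>A single unit jump from 0 shows that \<open>C\<close> is nonnegative, so
      multiplication by \<open>C\<close> preserves inequalities.\<close>
    have "1 \<le> C * 1"
      using weak_type_ineq_attains[OF C sq_attains_jump[of 1 0]] by simp
    then have "0 \<le> C" by simp
    have "Psi 1 * sqrt n \<le> C * (Psi 1 * c)" using mult_left_mono[OF sc, of "Psi 1"] k by (simp add: mult_ac)
    also have "\<dots> \<le> C * (sqrt n + B)" using c(2) \<open>0 \<le> C\<close> by (rule mult_left_mono)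
    finally show ?thesis using s by (simp add: field_simps)
  qed
  moreover have "(\<lambda>n. C * (1 + B / sqrt (real n))) \<longlonglongrightarrow> C * (1 + 0)"
    by (intro tendsto_intros tendsto_divide_0[OF tendsto_const] filterlim_at_top_imp_at_infinity
        filterlim_compose[OF sqrt_at_top filterlim_real_sequentially])
  ultimately show ?thesis using LIMSEQ_le_const[of _ "C * (1 + 0)" "Psi 1"] by auto
qed

theorem corollary4p3:
  shows "weak_type_ineq (Psi 1) \<and> (\<forall>C. weak_type_ineq C \<longrightarrow> Psi 1 \<le> C)"
  using weak_type_Psi_1 Psi_1_optimal by blast

end
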